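(* For each $n\in\mathbb N$, let $\mathbf p_n = (p_{n,j})_{j\in\Sigma}$ be a probability vector with strictly positive entries such that $\sup_n \sum_{r\in\Sigma_R} p_{n,r} K_r^{-\alpha_{\min}} < 1$, and assume that $\lim_{n\to\infty}\mathbf p_n = \mathbf p$ in $\mathbb R_+^N$. Then $\frac{d\mu_{\mathbf p_n}}{d\lambda}$ converges with respect to the $L^1(\lambda)$-norm to $\frac{d\mu_{\mathbf p}}{d\lambda}$.
   Context: For $\alpha \in (0,\infty)$ let $S_\alpha : [0,1]\to[0,1]$ be given by $S_\alpha(x) = x(1+2^\alpha x^\alpha)$ if $x \in [0,\frac12]$ and $S_\alpha(x) = 2x-1$ if $x \in (\frac12,1]$. For $\alpha \in (0,\infty)$ and $K \in (0,1)$ let $R_{\alpha,K}:[0,1]\to[0,1]$ be given by $R_{\alpha,K}(x) = x(1+2^\alpha x^\alpha)$ if $x \in [0,\frac12]$ and $R_{\alpha,K}(x) = \frac12 + K(x-\frac12) + 2(1-K)(x-\frac12)^2$ if $x\in(\frac12,1]$. Let $\mathfrak S = \{S_\alpha : \alpha \in (0,\infty)\}$ and $\mathfrak R = \{R_{\alpha,K} : \alpha\in(0,\infty), K\in(0,1)\}$. Let $T_1,\ldots,T_N \in \mathfrak S \cup \mathfrak R$ be a finite collection, $\Sigma = \{1,\ldots,N\}$, $\Sigma_S = \{j \in \Sigma : T_j \in \mathfrak S\}$, $\Sigma_R = \{j\in\Sigma : T_j \in \mathfrak R\}$, and assume $\Sigma_S, \Sigma_R \neq \emptyset$. For $j \in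 \Sigma$ let $\alpha_j\in(0,\infty)$ be the parameter with $T_j(x) = x(1+2^{\alpha_j}x^{\alpha_j})$ on $[0,\frac12]$; for $j \in \Sigma_R$ let $K_j \in (0,1)$ be the parameter with $T_j(x) = \frac12 + K_j(x-\frac12)+2(1-K_j)(x-\frac12)^2$ on $(\frac12,1]$. Let $\alpha_{\min} = \min\{\alpha_j : j \in \Sigma\}$; it is assumed throughout that $\alpha_{\min}<1$. Let $\mathbf p = (p_j)_{j\in\Sigma}$ be a probability vector with strictly positive entries, and let $\lambda$ be Lebesgue measure on $[0,1]$. For a probability vector $\mathbf q = (q_j)_{j\in\Sigma}$ with strictly positive entries and $\sum_{r\in\Sigma_R} q_r K_r^{-\alpha_{\min}}<1$, $\mu_{\mathbf q}$ denotes the unique Borel probability measure on $[0,1]$ that is absolutely continuous with respect to $\lambda$ and satisfies $\sum_{j\in\Sigma} q_j\,\mu_{\mathbf q}(T_j^{-1}A) = \mu_{\mathbf q}(A)$ for all Borel sets $A\subseteq[0,1]$. (Existence and uniqueness of this measure is a theorem of the paper; note that the hypotheses of the claim imply $\sum_{r\in\Sigma_R} p_r K_r^{-\alpha_{\min}}<1$, so $\mu_{\mathbf p}$ is defined.) *)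

theory Defs
  imports "HOL-Probability.Probability"
begin

text \<open>A map from \<open>[0,1]\<close> to \<open>[0,1]\<close> is represented by a function on the reals that is
  \<^const>\<open>undefined\<close> off \<open>[0,1]\<close>, so that equality of functions is equality on \<open>[0,1]\<close>.
  Note that \<open>0 powr \<alpha> = 0\<close>.\<close>

definition S_map :: "real \<Rightarrow> real \<Rightarrow> real" where
  "S_map \<alpha> = (\<lambda>x\<in>{0..1}. if x \<le> 1/2 then x * (1 + 2 powr \<alpha> * x powr \<alpha>) else 2 * x - 1)"

definition R_map :: "real \<Rightarrow> real \<Rightarrow> real \<Rightarrow> real" where
  "R_map \<alpha> K = (\<lambda>x\<in>{0..1}. if x \<le> 1/2 then x * (1 + 2 powr \<alpha> * x powr \<alpha>)
     else 1/2 + K * (x - 1/2) + 2 * (1 - K) * (x - 1/2)\<^sup>2)"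

definition S_family :: "(real \<Rightarrow> real) set" where
  "S_family = {S_map \<alpha> |\<alpha>. 0 < \<alpha>}"

definition R_family :: "(real \<Rightarrow> real) set" where
  "R_family = {R_map \<alpha> K |\<alpha> K. 0 < \<alpha> \<and> 0 < K \<and> K < 1}"

text \<open>The finite index set \<open>\<Sigma> = {1,\<dots>,N}\<close> is the universe of a finite type \<open>'n\<close>, and
  vectors indexed by \<open>\<Sigma>\<close> are elements of \<^typ>\<open>real ^ 'n\<close>.\<close>

definition Sigma_S :: "('n::finite \<Rightarrow> real \<Rightarrow> real) \<Rightarrow> 'n set" where
  "Sigma_S T = {j. T j \<in> S_family}"

definition Sigma_R :: "('n::finite \<Rightarrow> real \<Rightarrow> real) \<Rightarrow> 'n set" where
  "Sigma_R T = {j. T j \<in> R_family}"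

definition pos_prob_vector :: "real ^ 'n \<Rightarrow> bool" where
  "pos_prob_vector q \<longleftrightarrow> (\<forall>j. 0 < q $ j) \<and> (\<Sum>j\<in>UNIV. q $ j) = 1"

definition unit_lebesgue :: "real measure" where
  "unit_lebesgue = restrict_space lborel {0..1}"

definition is_acs_measure :: "('n::finite \<Rightarrow> real \<Rightarrow> real) \<Rightarrow> real ^ 'n \<Rightarrow> real measure \<Rightarrow> bool" where
  "is_acs_measure T q \<mu> \<longleftrightarrow>
     prob_space \<mu> \<and> sets \<mu> = sets (restrict_space borel {0..1}) \<and>
     absolutely_continuous unit_lebesgue \<mu> \<and>
     (\<forall>A\<in>sets (restrict_space borel {0..1}).
        (\<Sum>j\<in>UNIV. q $ j * measure \<mu> (T j -` A \<inter> {0..1})) = measure \<mu> A)"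

text \<open>Meaningful only when such a measure exists and is unique.\<close>

definition acs_measure :: "('n::finite \<Rightarrow> real \<Rightarrow> real) \<Rightarrow> real ^ 'n \<Rightarrow> real measure" where
  "acs_measure T q = (THE \<mu>. is_acs_measure T q \<mu>)"

text \<open>\<^const>\<open>RN_deriv\<close> takes values in \<^typ>\<open>ennreal\<close>; the density of a probability measure is
  almost everywhere finite, so the conversion alters it on a null set only.\<close>

definition acs_density :: "('n::finite \<Rightarrow> real \<Rightarrow> real) \<Rightarrow> real ^ 'n \<Rightarrow> real \<Rightarrow> real" where
  "acs_density T q x = enn2real (RN_deriv unit_lebesgue (acs_measure T q) x)"

text \<open>The norm takes the value \<open>\<infinity>\<close> on measurable functions that are not integrable, so
  its convergence to \<open>0\<close> cannot come from a junk value of the Bochner integral.\<close>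

definition L1_norm :: "'a measure \<Rightarrow> ('a \<Rightarrow> real) \<Rightarrow> ennreal" where
  "L1_norm M f = (\<integral>\<^sup>+x. ennreal \<bar>f x\<bar> \<partial>M)"

end

theory Submission
  imports Defs "HOL-Complex_Analysis.Great_Picard"
begin

text \<open>
  Let \<open>\<alpha> = \<alpha>\<^sub>m\<^sub>i\<^sub>n\<close> and pick \<open>\<gamma> > \<alpha>\<close> so close to \<open>\<alpha>\<close> that \<open>\<Sum>\<^sub>r q\<^sub>r K\<^sub>r powr (-\<gamma>) \<le> \<theta> < 1\<close> holds uniformly for
  \<open>q = p\<close> and all \<open>q = p\<^sub>n\<close>. The transfer operators \<open>P q\<close> preserve a common cone of
  densities \<open>f\<close> that decrease on \<open>(0,1/2]\<close> and on \<open>(1/2,1]\<close> and satisfy \<open>f x \<le> A x powr (\<gamma>-1-\<alpha>)\<close> on the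
  left and \<open>f x \<le> B (x-1/2) powr (\<gamma>-1)\<close> on the right. By Helly's selection theorem and
  dominated convergence the cone is compact in \<open>L\<^sup>1\<close>, so Cesaro averages have limit points in it,
  which are invariant densities.

  If two invariant densities in the cone differ, the positive and negative parts of their difference are
  both invariant and both positive on some interval; a map \<open>S\<^sub>\<alpha>\<close> spreads this positivity to a
  neighbourhood of \<open>0\<close>, a contradiction. Hence Cesaro averages of the indicators of \<open>(0,b]\<close>, and then
  of all integrable functions, converge to multiples of the invariant density in the cone, which
  gives uniqueness in \<open>L\<^sup>1\<close>. Finally, \<open>P q\<close> depends continuously on \<open>q\<close> in operator norm,
  so every limit point of the densities for \<open>p\<^sub>n\<close> is the density for \<open>p\<close>.
\<close>

section \<open>Transfer operators of increasing branches\<close>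

text \<open>The exponents balance two singularities. Near 1/2 an R branch reproduces the profile
  \<open>(x - 1/2) powr (\<gamma> - 1)\<close> with a factor at most
  \<open>K j powr (-\<gamma>)\<close>, so an average factor \<theta> < 1 closes the bound on the
  right half. An S branch copies this singularity to 0. There the neutral left branch improves a
  power x powr (-\<delta>) only by a relative amount of order x powr \<alpha>, so the copied
  singularity is absorbed when \<alpha> - \<delta> = \<gamma> - 1, and integrability at 0, that is
  \<delta> < 1, means \<gamma> > \<alpha>. The strictness of the uniform bound on the sums is spent
  on raising the exponent from \<alpha> to \<gamma>. The gain at 0 carries the weight of an index
  with minimal exponent, so that weight has to stay away from 0 along the whole sequence.

  Since \<open>acs_measure\<close> is a definite description, existence and uniqueness of the
  measure must be proved before its density can be discussed. A competing measure has an arbitrary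
  integrable density, whose positivity set may contain no interval; the detour through Cesaro
  averages transfers uniqueness from the cone to such densities.\<close>

definition increasing_branch :: "(real \<Rightarrow> real) \<Rightarrow> (real \<Rightarrow> real) \<Rightarrow> bool" where
  "increasing_branch \<phi> D \<longleftrightarrow> (\<forall>y. (\<phi> has_real_derivative D y) (at y)) \<and> continuous_on UNIV D \<and>
     (\<exists>k>0. \<forall>y. k \<le> D y)"

text \<open>The Perron-Frobenius operator of one branch: a density is sent to the density of its
  image under \<open>\<phi>\<close>.\<close>

definition transfer :: "(real \<Rightarrow> real) \<Rightarrow> (real \<Rightarrow> real) \<Rightarrow> (real \<Rightarrow> real) \<Rightarrow> real \<Rightarrow> real" where
  "transfer \<phi> D f x = f (inv \<phi> x) / D (inv \<phi> x)"

context
  fixes \<phi> D :: "real \<Rightarrow> real"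
  assumes br: "increasing_branch \<phi> D"
begin

lemma branch_deriv: "(\<phi> has_real_derivative D y) (at y)"
  using br by (auto simp: increasing_branch_def)

lemma branch_D_pos: "0 < D y"
  using br by (meson increasing_branch_def less_le_trans)

lemma branch_D_cont: "continuous_on UNIV D"
  using br by (auto simp: increasing_branch_def)

lemma branch_D_measurable: "D \<in> borel_measurable borel"
  by (rule borel_measurable_continuous_onI[OF branch_D_cont])

lemma branch_cont: "continuous_on A \<phi>"
  by (meson DERIV_isCont branch_deriv continuous_at_imp_continuous_on)

lemma branch_measurable: "\<phi> \<in> borel_measurable borel"
  by (rule borel_measurable_continuous_onI[OF branch_cont])

lemma branch_strict_mono: "strict_mono \<phi>"
  by (rule strict_monoI, rule DERIV_pos_imp_increasing) (use branch_deriv branch_D_pos in blast)+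

lemma branch_less_iff [simp]: "\<phi> x < \<phi> y \<longleftrightarrow> x < y"
  by (simp add: branch_strict_mono strict_mono_less)

lemma branch_le_iff [simp]: "\<phi> x \<le> \<phi> y \<longleftrightarrow> x \<le> y"
  by (simp add: branch_strict_mono strict_mono_less_eq)

text \<open>The uniform lower bound on \<open>D\<close> forces at least linear growth in both
  directions; positivity of the derivative alone would allow bounded maps. Surjectivity makes
  \<open>inv \<phi>\<close> a genuine inverse on the whole line.\<close>

lemma branch_surj: "surj \<phi>"
proof -
  obtain k where k: "k > 0" "\<And>y. k \<le> D y" using br by (auto simp: increasing_branch_def)
  have gr: "k * (b - a) \<le> \<phi> b - \<phi> a" if "a \<le> b" for a b
  proof -
    have "(\<lambda>x. \<phi> x - k * x) a \<le> (\<lambda>x. \<phi> x - k * x) b"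
      by (rule DERIV_nonneg_imp_nondecreasing[OF that])
         (use k in \<open>auto intro!: exI derivative_eq_intros branch_deriv\<close>)
    then show ?thesis by (simp add: algebra_simps)
  qed
  have "\<exists>y. \<phi> y = x" for x
  proof -
    define b where "b = \<bar>x - \<phi> 0\<bar> / k"
    have b: "b \<ge> 0" "k * b = \<bar>x - \<phi> 0\<bar>" using k by (auto simp: b_def)
    have "\<phi> (-b) \<le> x" "x \<le> \<phi> b" using gr[of "-b" 0] gr[of 0 b] b by auto
    then show ?thesis using IVT'[of \<phi> "-b" x b] b branch_cont by auto
  qed
  then show ?thesis by (metis surjI)
qed

lemma branch_inv [simp]: "inv \<phi> (\<phi> y) = y" "\<phi> (inv \<phi> x) = x"
  by (simp_all add: branch_strict_mono strict_mono_imp_inj_on branch_surj surj_f_inv_f)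

lemma inv_branch_le: "inv \<phi> x \<le> y \<longleftrightarrow> x \<le> \<phi> y" "y \<le> inv \<phi> x \<longleftrightarrow> \<phi> y \<le> x"
  by (metis branch_inv(2) branch_le_iff)+

lemma inv_branch_less: "inv \<phi> x < y \<longleftrightarrow> x < \<phi> y" "y < inv \<phi> x \<longleftrightarrow> \<phi> y < x"
  by (metis branch_inv(2) branch_less_iff)+

lemma inv_branch_mono: "mono (inv \<phi>)"
  by (rule monoI) (simp add: inv_branch_le)

lemma inv_branch_measurable: "inv \<phi> \<in> borel_measurable borel"
  by (rule borel_measurable_mono[OF inv_branch_mono])

lemma transfer_measurable:
  assumes [measurable]: "f \<in> borel_measurable borel"
  shows "transfer \<phi> D f \<in> borel_measurable borel"
proof -
  note [measurable] = branch_D_measurable inv_branch_measurable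
  show ?thesis unfolding transfer_def by measurable
qed

text \<open>Change of variables, checked on open intervals: the preimage is again an interval, and
  its weight is given by the fundamental theorem of calculus for \<open>D\<close>. The substitution
  rules for a branch all reduce to this.\<close>

lemma distr_branch: "distr (density lborel (\<lambda>y. ennreal (D y))) borel \<phi> = lborel"
proof (rule lborel_eqI[symmetric])
  note [measurable] = branch_D_measurable branch_measurable
  fix l u :: real assume "\<And>b. b \<in> Basis \<Longrightarrow> l \<bullet> b \<le> u \<bullet> b"
  then have lu: "l \<le> u" by simp
  have vim: "\<phi> -` box l u = {inv \<phi> l<..<inv \<phi> u}"
    by (auto simp: box_real inv_branch_less)
  have le: "inv \<phi> l \<le> inv \<phi> u" using lu inv_branch_mono by (simp add: mono_def)
  have "emeasure (distr (density lborel D) borel \<phi>) (box l u) = (\<integral>\<^sup>+y. ennreal (D y) * indicator {inv \<phi> l<..<inv \<phi> u} y \<partial>lborel)"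
    using lu by (simp add: emeasure_distr vim[unfolded box_real] emeasure_density box_real ennreal_mult' ennreal_indicator)
  also have "\<dots> = (\<integral>\<^sup>+y. ennreal (D y) * indicator {inv \<phi> l..inv \<phi> u} y \<partial>lborel)"
  proof (rule nn_integral_cong_AE)
    show "AE y in lborel. ennreal (D y) * indicator {inv \<phi> l<..<inv \<phi> u} y = ennreal (D y) * indicator {inv \<phi> l..inv \<phi> u} y"
      using AE_lborel_singleton[of "inv \<phi> l"] AE_lborel_singleton[of "inv \<phi> u"]
      by eventually_elim (auto simp: indicator_def)
  qed
  also have "\<dots> = \<phi> (inv \<phi> u) - \<phi> (inv \<phi> l)"
    by (rule nn_integral_FTC_Icc[OF _ _ _ le])
       (auto intro: branch_deriv less_imp_le branch_D_pos)
  finally show "emeasure (distr (density lborel D) borel \<phi>) (box l u) = (\<Prod>b\<in>Basis. (u - l) \<bullet> b)" 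
    by simp
qed simp

lemma AE_branch:
  assumes "Measurable.pred borel P"
  shows "(AE x in lborel. P x) \<longleftrightarrow> (AE y in lborel. P (\<phi> y))"
proof -
  note [measurable] = branch_D_measurable branch_measurable inv_branch_measurable transfer_measurable
  have "(AE x in lborel. P x) \<longleftrightarrow> (AE x in distr (density lborel (\<lambda>y. ennreal (D y))) borel \<phi>. P x)"
    by (simp only: distr_branch)
  also have "\<dots> \<longleftrightarrow> (AE y in lborel. P (\<phi> y))"
    using assms by (subst AE_distr_iff) (auto simp: AE_density branch_D_pos)
  finally show ?thesis .
qed

text \<open>\<open>AE_branch\<close> asks for a measurable predicate, so an arbitrary
  \<open>P\<close> is first replaced by avoidance of a Borel null set \<open>N\<close>.\<close>

lemma AE_inv_branch:
  assumes "AE y in lborel. P y"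
  shows "AE x in lborel. P (inv \<phi> x)"
proof -
  note [measurable] = branch_D_measurable branch_measurable inv_branch_measurable transfer_measurable
  obtain N where N: "N \<in> null_sets lborel" "\<And>y. y \<notin> N \<Longrightarrow> P y"
    by (rule AE_E3[OF assms]) simp
  have "AE y in lborel. y \<notin> N" by (rule AE_not_in[OF N(1)])
  then have "AE y in lborel. inv \<phi> (\<phi> y) \<notin> N" by simp
  moreover have [measurable]: "N \<in> sets borel" using N by auto
  ultimately have "AE x in lborel. inv \<phi> x \<notin> N"
    by (subst AE_branch) auto
  then show ?thesis using N by (auto elim!: eventually_mono)
qed

text \<open>Duality between the transfer operator and composition with \<open>\<phi>\<close>: after
  substituting x = \<open>\<phi> y\<close> the Jacobian \<open>D y\<close> cancels the denominator
  in \<open>transfer\<close>.\<close>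

lemma
  assumes [measurable]: "u \<in> borel_measurable borel" "f \<in> borel_measurable borel"
  shows integrable_transfer_iff:
      "integrable lborel (\<lambda>x. u x * transfer \<phi> D f x) \<longleftrightarrow> integrable lborel (\<lambda>y. u (\<phi> y) * f y)"
    and integral_transfer:
      "(\<integral>x. u x * transfer \<phi> D f x \<partial>lborel) = (\<integral>y. u (\<phi> y) * f y \<partial>lborel)"
proof -
  note [measurable] = branch_D_measurable branch_measurable inv_branch_measurable transfer_measurable
  have nz: "D y \<noteq> 0" for y using branch_D_pos[of y] by simp
  have 1: "D y * (u (\<phi> y) * transfer \<phi> D f (\<phi> y)) = u (\<phi> y) * f y" for y
    using nz[of y] by (simp add: transfer_def)
  have *: "AE y in lborel. 0 \<le> D y" by (simp add: branch_D_pos less_imp_le)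
  show "integrable lborel (\<lambda>x. u x * transfer \<phi> D f x) \<longleftrightarrow> integrable lborel (\<lambda>y. u (\<phi> y) * f y)"
    apply (subst distr_branch[symmetric], subst integrable_distr_eq)
      apply simp apply measurable
    using * by (simp add: integrable_density 1)
  show "(\<integral>x. u x * transfer \<phi> D f x \<partial>lborel) = (\<integral>y. u (\<phi> y) * f y \<partial>lborel)"
    apply (subst distr_branch[symmetric], subst integral_distr)
      apply simp apply measurable
    using * by (simp add: integral_density 1)
qed

end

section \<open>The annealed transfer operator\<close>

lemma DERIV_mult_abs_powr:
  fixes a y :: real
  assumes "0 < a"
  shows "((\<lambda>y. y * \<bar>y\<bar> powr a) has_real_derivative (1 + a) * \<bar>y\<bar> powr a) (at y)"
proof -
  consider "y > 0" | "y < 0" | "y = 0" by linarith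
  then show ?thesis
  proof cases
    case 1
    have "((\<lambda>y. y * y powr a) has_real_derivative (1 + a) * \<bar>y\<bar> powr a) (at y)"
      using 1 by (auto intro!: derivative_eq_intros simp: powr_diff field_simps)
    then show ?thesis
      by (rule DERIV_cong_ev[THEN iffD1, rotated 3, OF _ refl _ refl])
         (use 1 eventually_nhds_in_open[of "{0<..}" y] in \<open>auto elim!: eventually_mono\<close>)
  next
    case 2
    have "((\<lambda>y. y * (- y) powr a) has_real_derivative (1 + a) * \<bar>y\<bar> powr a) (at y)"
      using 2 by (auto intro!: derivative_eq_intros simp: powr_diff field_simps)
    then show ?thesis
      by (rule DERIV_cong_ev[THEN iffD1, rotated 3, OF _ refl _ refl])
         (use 2 eventually_nhds_in_open[of "{..<0}" y] in \<open>auto elim!: eventually_mono\<close>)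
  next
    case 3
    have "((\<lambda>h::real. \<bar>h\<bar> powr a) \<longlongrightarrow> 0) (at 0)"
      using assms by (auto intro!: tendsto_eq_intros)
    then have "((\<lambda>h::real. (h * \<bar>h\<bar> powr a) / h) \<longlongrightarrow> 0) (at 0)"
      by (rule Lim_transform_eventually) (auto simp: eventually_at_filter)
    then show ?thesis using 3 by (simp add: DERIV_def)
  qed
qed

text \<open>The absolute value makes the formula an odd function, hence increasing on the whole
  line; on [0,1/2] it is the left branch shared by both families.\<close>

definition left_map :: "real \<Rightarrow> real \<Rightarrow> real" where
  "left_map a y = y * (1 + 2 powr a * \<bar>y\<bar> powr a)"

definition left_D :: "real \<Rightarrow> real \<Rightarrow> real" where
  "left_D a y = 1 + (1 + a) * (2 powr a * \<bar>y\<bar> powr a)"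

text \<open>The square is replaced by its odd version about 1/2, which keeps the slope at least
  \<open>k\<close> on both sides when \<open>c\<close> is nonnegative. The parameters 1/2, K, 2(1-K)
  give the right branch of an R map and 0, 2, 0 that of an S map.\<close>

definition right_map :: "real \<Rightarrow> real \<Rightarrow> real \<Rightarrow> real \<Rightarrow> real" where
  "right_map s k c y = s + k * (y - 1/2) + c * ((y - 1/2) * \<bar>y - 1/2\<bar>)"

definition right_D :: "real \<Rightarrow> real \<Rightarrow> real \<Rightarrow> real" where
  "right_D k c y = k + 2 * c * \<bar>y - 1/2\<bar>"

lemma increasing_branch_left:
  assumes "0 < a"
  shows "increasing_branch (left_map a) (left_D a)"
  unfolding increasing_branch_def
proof (intro conjI allI)
  fix y
  have "((\<lambda>y. y + 2 powr a * (y * \<bar>y\<bar> powr a)) has_real_derivative left_D a y) (at y)"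
    unfolding left_D_def
    by (rule derivative_eq_intros DERIV_mult_abs_powr assms refl)+ (simp add: algebra_simps)
  then show "(left_map a has_real_derivative left_D a y) (at y)"
    by (simp add: left_map_def[abs_def] algebra_simps)
next
  show "continuous_on UNIV (left_D a)"
    unfolding left_D_def by (intro continuous_intros continuous_on_powr') (use assms in auto)
next
  show "\<exists>k>0. \<forall>y. k \<le> left_D a y"
    using assms by (intro exI[of _ 1]) (auto simp: left_D_def)
qed

lemma increasing_branch_right:
  assumes "0 < k" "0 \<le> c"
  shows "increasing_branch (right_map s k c) (right_D k c)"
  unfolding increasing_branch_def
proof (intro conjI allI)
  fix y :: real
  have "((\<lambda>y. y * \<bar>y\<bar>) has_real_derivative 2 * \<bar>y - 1/2\<bar>) (at (y - 1/2))"
    using DERIV_mult_abs_powr[of 1 "y - 1/2"] by simp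
  then have "((\<lambda>y. (y - 1/2) * \<bar>y - 1/2\<bar>) has_real_derivative (2 * \<bar>y - 1/2\<bar>) * 1) (at y)"
    by (rule DERIV_chain2) (auto intro!: derivative_eq_intros)
  moreover have "((\<lambda>y. s + k * (y - 1/2)) has_real_derivative k) (at y)"
    by (auto intro!: derivative_eq_intros)
  ultimately have "((\<lambda>y. s + k * (y - 1/2) + c * ((y - 1/2) * \<bar>y - 1/2\<bar>)) has_real_derivative
      k + c * (2 * \<bar>y - 1/2\<bar> * 1)) (at y)"
    by (intro DERIV_add DERIV_cmult)
  then show "(right_map s k c has_real_derivative right_D k c y) (at y)"
    by (simp add: right_map_def[abs_def] right_D_def mult_ac)
next
  show "continuous_on UNIV (right_D k c)"
    unfolding right_D_def by (intro continuous_intros)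
next
  show "\<exists>k'>0. \<forall>y. k' \<le> right_D k c y"
    using assms by (intro exI[of _ k]) (auto simp: right_D_def)
qed

lemma left_map_simps [simp]: "left_map a 0 = 0" "left_map a (1/2) = 1"
  by (simp_all add: left_map_def powr_divide)

lemma left_map_le:
  assumes "0 < a" "0 \<le> y" "y \<le> 1/2"
  shows "left_map a y \<le> 2 * y"
proof -
  have "(2 * y) powr a \<le> 1" using assms by (intro powr_le1) auto
  then have "y * (1 + 2 powr a * \<bar>y\<bar> powr a) \<le> y * 2"
    using assms by (intro mult_left_mono) (auto simp: powr_mult)
  then show ?thesis by (simp add: left_map_def)
qed

text \<open>\<open>R\<close> plays the role of \<open>\<Sigma>\<^sub>R\<close>; the branches are extended to increasing bijections of the
  whole line, so that inverse branches are total and images of the domains take care of themselves.\<close>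

locale random_maps =
  fixes R :: "'n::finite set" and \<alpha> K :: "'n \<Rightarrow> real"
  assumes alpha_pos: "0 < \<alpha> j"
    and K_bounds: "j \<in> R \<Longrightarrow> 0 < K j \<and> K j < 1"
    and ex_S: "R \<noteq> UNIV"
begin

definition lmap :: "'n \<Rightarrow> real \<Rightarrow> real" where "lmap j = left_map (\<alpha> j)"
definition lD :: "'n \<Rightarrow> real \<Rightarrow> real" where "lD j = left_D (\<alpha> j)"
definition rmap :: "'n \<Rightarrow> real \<Rightarrow> real" where
  "rmap j = (if j \<in> R then right_map (1/2) (K j) (2 * (1 - K j)) else right_map 0 2 0)"
definition rD :: "'n \<Rightarrow> real \<Rightarrow> real" where
  "rD j = (if j \<in> R then right_D (K j) (2 * (1 - K j)) else right_D 2 0)"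

lemma branch_l: "increasing_branch (lmap j) (lD j)"
  unfolding lmap_def lD_def by (intro increasing_branch_left alpha_pos)

lemma branch_r: "increasing_branch (rmap j) (rD j)"
  using K_bounds[of j] unfolding rmap_def rD_def by (auto intro!: increasing_branch_right)

lemma lmap_simps [simp]: "lmap j 0 = 0" "lmap j (1/2) = 1"
  by (auto simp: lmap_def)

lemma rmap_1 [simp]: "rmap j 1 = 1"
  by (auto simp: rmap_def right_map_def field_simps)

lemma rmap_half: "rmap j (1/2) = (if j \<in> R then 1/2 else 0)"
  by (auto simp: rmap_def right_map_def field_simps)

lemmas [measurable] = branch_measurable[OF branch_l] branch_measurable[OF branch_r]
  inv_branch_measurable[OF branch_l] inv_branch_measurable[OF branch_r]
  branch_D_measurable[OF branch_l] branch_D_measurable[OF branch_r]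

text \<open>Both cuts are left-open. Dropping the point 0 costs a null set and makes
  \<open>P q f\<close> vanish off (0,1] at every point, not only almost everywhere.\<close>

abbreviation lpart :: "(real \<Rightarrow> real) \<Rightarrow> real \<Rightarrow> real" where
  "lpart f \<equiv> \<lambda>y. indicator {0<..1/2} y * f y"
abbreviation rpart :: "(real \<Rightarrow> real) \<Rightarrow> real \<Rightarrow> real" where
  "rpart f \<equiv> \<lambda>y. indicator {1/2<..1} y * f y"

definition P :: "real ^ 'n \<Rightarrow> (real \<Rightarrow> real) \<Rightarrow> real \<Rightarrow> real" where
  "P q f x = (\<Sum>j\<in>UNIV. q $ j * (transfer (lmap j) (lD j) (lpart f) x + transfer (rmap j) (rD j) (rpart f) x))"

definition tmap :: "'n \<Rightarrow> real \<Rightarrow> real" where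
  "tmap j y = (if y \<le> 1/2 then lmap j y else rmap j y)"

lemma tmap_measurable[measurable]: "tmap j \<in> borel_measurable borel"
  unfolding tmap_def by measurable

lemma P_measurable[measurable]: "f \<in> borel_measurable borel \<Longrightarrow> P q f \<in> borel_measurable borel"
  unfolding P_def
  by (intro borel_measurable_sum borel_measurable_times borel_measurable_add borel_measurable_const
      transfer_measurable[OF branch_l] transfer_measurable[OF branch_r]) simp_all

lemma P_add: "P q (\<lambda>x. f x + g x) x = P q f x + P q g x"
  by (simp add: P_def transfer_def distrib_left add_divide_distrib sum.distrib algebra_simps)

lemma P_scale: "P q (\<lambda>x. c * f x) x = c * P q f x"
  unfolding P_def sum_distrib_left
  by (rule sum.cong) (auto simp: transfer_def algebra_simps)

lemma P_diff: "P q (\<lambda>x. f x - g x) x = P q f x - P q g x"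
  using P_add[of q f "\<lambda>x. (-1) * g x" x] P_scale[of q "-1" g x] by simp

lemma P_zero: "P q (\<lambda>x. 0) x = 0"
  using P_scale[of q 0 "\<lambda>x. 0" x] by simp

lemma P_sum: "finite A \<Longrightarrow> P q (\<lambda>x. \<Sum>k\<in>A. f k x) x = (\<Sum>k\<in>A. P q (f k) x)"
  by (induction A rule: finite_induct) (auto simp: P_zero P_add)

lemma P_mono:
  assumes q: "\<And>j. 0 \<le> q $ j" and fg: "\<And>x. f x \<le> g x"
  shows "P q f x \<le> P q g x"
  unfolding P_def transfer_def
  by (intro sum_mono mult_left_mono add_mono divide_right_mono q)
     (auto simp: fg mult_left_mono less_imp_le branch_D_pos[OF branch_l] branch_D_pos[OF branch_r])

lemma P_nonneg:
  assumes q: "\<And>j. 0 \<le> q $ j" and f: "\<And>x. 0 \<le> f x"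
  shows "0 \<le> P q f x"
  using P_mono[of q "\<lambda>x. 0" f x] assms by (simp add: P_zero)

lemma P_abs:
  assumes q: "\<And>j. 0 \<le> q $ j"
  shows "\<bar>P q f x\<bar> \<le> P q (\<lambda>x. \<bar>f x\<bar>) x"
proof -
  have "P q (\<lambda>x. (-1) * f x) x \<le> P q (\<lambda>x. \<bar>f x\<bar>) x"
    by (rule P_mono[OF q]) simp
  moreover have "P q f x \<le> P q (\<lambda>x. \<bar>f x\<bar>) x"
    by (rule P_mono[OF q]) simp
  moreover note P_scale[of q "-1" f x]
  ultimately show ?thesis by simp
qed

text \<open>The value of \<open>P q f\<close> at x involves \<open>f\<close> only at inverse images
  of x, and exceptional null sets stay null when pulled back along these finitely many inverse
  branches. Thus \<open>P\<close> acts on classes modulo null sets.\<close>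

lemma P_AE_cong:
  assumes "AE x in lborel. f x = g x"
  shows "AE x in lborel. P q f x = P q g x"
proof -
  have "AE x in lborel. \<forall>j. f (inv (lmap j) x) = g (inv (lmap j) x) \<and> f (inv (rmap j) x) = g (inv (rmap j) x)"
    by (simp add: AE_all_countable AE_inv_branch[OF branch_l assms] AE_inv_branch[OF branch_r assms])
  then show ?thesis
    by eventually_elim (auto simp: P_def transfer_def intro!: sum.cong)
qed

text \<open>The branch dualities add up to a duality with the random map. The indicator of (0,1]
  records that \<open>P\<close> discards mass elsewhere. With u = 1 this yields conservation of
  mass, with an indicator it expresses invariance of measures.\<close>

lemma
  assumes [measurable]: "u \<in> borel_measurable borel" and u: "\<And>x. \<bar>u x\<bar> \<le> 1"
    and f: "integrable lborel f"
  shows integrable_times_P: "integrable lborel (\<lambda>x. u x * P q f x)"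
    and integral_times_P: "(\<integral>x. u x * P q f x \<partial>lborel)
      = (\<Sum>j\<in>UNIV. q $ j * (\<integral>y. u (tmap j y) * (indicator {0<..1} y * f y) \<partial>lborel))"
proof -
  have [measurable]: "f \<in> borel_measurable borel" using f by simp
  have bd: "\<bar>u a * b\<bar> \<le> \<bar>b\<bar>" for a b
    using u[of a] by (simp add: abs_mult mult_left_le_one_le)
  have il: "integrable lborel (\<lambda>y. u (lmap j y) * lpart f y)" for j
    by (rule Bochner_Integration.integrable_bound[OF f])
       (auto simp: indicator_def bd)
  have ir: "integrable lborel (\<lambda>y. u (rmap j y) * rpart f y)" for j
    by (rule Bochner_Integration.integrable_bound[OF f])
       (auto simp: indicator_def bd)
  have ml: "integrable lborel (\<lambda>x. u x * transfer (lmap j) (lD j) (lpart f) x)"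
    and el: "(\<integral>x. u x * transfer (lmap j) (lD j) (lpart f) x \<partial>lborel) = (\<integral>y. u (lmap j y) * lpart f y \<partial>lborel)" for j
    using il by (auto simp: integrable_transfer_iff[OF branch_l] integral_transfer[OF branch_l])
  have mr: "integrable lborel (\<lambda>x. u x * transfer (rmap j) (rD j) (rpart f) x)"
    and er: "(\<integral>x. u x * transfer (rmap j) (rD j) (rpart f) x \<partial>lborel) = (\<integral>y. u (rmap j y) * rpart f y \<partial>lborel)" for j
    using ir by (auto simp: integrable_transfer_iff[OF branch_r] integral_transfer[OF branch_r])
  have eq: "u x * P q f x = (\<Sum>j\<in>UNIV. q $ j * (u x * transfer (lmap j) (lD j) (lpart f) x
        + u x * transfer (rmap j) (rD j) (rpart f) x))" for x
    unfolding P_def sum_distrib_left by (rule sum.cong) (auto simp: algebra_simps)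
  show "integrable lborel (\<lambda>x. u x * P q f x)"
    unfolding eq by (intro Bochner_Integration.integrable_sum integrable_mult_right Bochner_Integration.integrable_add ml mr)
  have "(\<integral>x. u x * P q f x \<partial>lborel) = (\<Sum>j\<in>UNIV. q $ j * ((\<integral>y. u (lmap j y) * lpart f y \<partial>lborel) + (\<integral>y. u (rmap j y) * rpart f y \<partial>lborel)))"
    unfolding eq
    by (subst Bochner_Integration.integral_sum)
       (auto simp: ml mr el er Bochner_Integration.integral_add)
  also have "\<dots> = (\<Sum>j\<in>UNIV. q $ j * (\<integral>y. u (tmap j y) * (indicator {0<..1} y * f y) \<partial>lborel))"
    by (intro sum.cong refl arg_cong2[of _ _ _ _ "(*)"], subst Bochner_Integration.integral_add[symmetric, OF il ir],
        rule Bochner_Integration.integral_cong)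
       (auto simp: tmap_def indicator_def)
  finally show "(\<integral>x. u x * P q f x \<partial>lborel) = \<dots>" .
qed

lemma
  assumes f: "integrable lborel f"
  shows integrable_P: "integrable lborel (P q f)"
    and integral_P: "(\<Sum>j\<in>UNIV. q $ j) = 1 \<Longrightarrow> (\<integral>x. P q f x \<partial>lborel) = (\<integral>y. indicator {0<..1} y * f y \<partial>lborel)"
  using integrable_times_P[of "\<lambda>_. 1", OF _ _ f, of q] integral_times_P[of "\<lambda>_. 1", OF _ _ f, of q]
  by (auto simp: sum_distrib_right[symmetric])

text \<open>A real number, so that estimates and limits stay in the reals. Being a Bochner integral
  it is 0 for non-integrable functions, hence the integrability premises in the lemmas about
  it.\<close>

definition l1 :: "(real \<Rightarrow> real) \<Rightarrow> real" where "l1 f = (\<integral>x. \<bar>f x\<bar> \<partial>lborel)"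

lemma l1_nonneg: "0 \<le> l1 f"
  by (simp add: l1_def)

lemma l1_triangle:
  assumes "integrable lborel f" "integrable lborel g"
  shows "l1 (\<lambda>x. f x + g x) \<le> l1 f + l1 g"
proof -
  have "l1 (\<lambda>x. f x + g x) \<le> (\<integral>x. \<bar>f x\<bar> + \<bar>g x\<bar> \<partial>lborel)"
    unfolding l1_def using assms by (intro integral_mono) (auto intro!: Bochner_Integration.integrable_add integrable_abs)
  also have "\<dots> = l1 f + l1 g"
    using assms by (simp add: l1_def)
  finally show ?thesis .
qed

lemma l1_triangle_diff:
  assumes "integrable lborel f" "integrable lborel g" "integrable lborel h"
  shows "l1 (\<lambda>x. f x - h x) \<le> l1 (\<lambda>x. f x - g x) + l1 (\<lambda>x. g x - h x)"
  using l1_triangle[of "\<lambda>x. f x - g x" "\<lambda>x. g x - h x"] assms by simp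

lemma l1_scale: "l1 (\<lambda>x. c * f x) = \<bar>c\<bar> * l1 f"
  by (simp add: l1_def abs_mult)

lemma l1_commute: "l1 (\<lambda>x. f x - g x) = l1 (\<lambda>x. g x - f x)"
  by (simp add: l1_def abs_minus_commute)

lemma l1_eq_0_iff: "integrable lborel f \<Longrightarrow> l1 f = 0 \<longleftrightarrow> (AE x in lborel. f x = 0)"
  unfolding l1_def by (subst integral_nonneg_eq_0_iff_AE) auto

lemma l1_sum:
  assumes "finite A" "\<And>k. k \<in> A \<Longrightarrow> integrable lborel (f k)"
  shows "l1 (\<lambda>x. \<Sum>k\<in>A. f k x) \<le> (\<Sum>k\<in>A. l1 (f k))"
  using assms
proof (induction A rule: finite_induct)
  case (insert a A)
  then show ?case
    using l1_triangle[of "f a" "\<lambda>x. \<Sum>k\<in>A. f k x"] by fastforce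
qed (simp add: l1_def)

text \<open>Positivity gives |P f| \<le> P |f|, and \<open>P\<close> preserves the mass on
  (0,1].\<close>

lemma l1_P:
  assumes q: "\<And>j. 0 \<le> q $ j" and q1: "(\<Sum>j\<in>UNIV. q $ j) = 1" and f: "integrable lborel f"
  shows "l1 (P q f) \<le> l1 f"
proof -
  have "l1 (P q f) \<le> (\<integral>x. P q (\<lambda>x. \<bar>f x\<bar>) x \<partial>lborel)"
    unfolding l1_def using f by (intro integral_mono integrable_abs integrable_P P_abs[OF q]) auto
  also have "\<dots> = (\<integral>y. indicator {0<..1} y * \<bar>f y\<bar> \<partial>lborel)"
    using f by (intro integral_P q1) auto
  also have "\<dots> \<le> l1 f"
    unfolding l1_def using f integrable_mult_indicator[of "{0<..1}" lborel "\<lambda>y. \<bar>f y\<bar>"]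
    by (intro integral_mono) (auto simp: indicator_def)
  finally show ?thesis .
qed

text \<open>\<open>P q\<close> is linear in \<open>q\<close>, and each \<open>P (axis j 1)\<close>,
  the operator of a single map, is an L1 contraction.\<close>

lemma l1_P_diff_weights:
  assumes f: "integrable lborel f"
  shows "l1 (\<lambda>x. P q f x - P q' f x) \<le> (\<Sum>j\<in>UNIV. \<bar>q $ j - q' $ j\<bar>) * l1 f"
proof -
  have "P q f x - P q' f x = (\<Sum>j\<in>UNIV. (q $ j - q' $ j) * P (axis j 1) f x)" for x
  proof -
    have "P (axis j 1) f x = transfer (lmap j) (lD j) (lpart f) x + transfer (rmap j) (rD j) (rpart f) x" for j
      unfolding P_def by (simp add: axis_def if_distrib[of "\<lambda>c. c * _"] cong: if_cong)
    then show ?thesis by (simp add: P_def left_diff_distrib sum_subtractf)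
  qed
  then have "l1 (\<lambda>x. P q f x - P q' f x) \<le> (\<Sum>j\<in>UNIV. l1 (\<lambda>x. (q $ j - q' $ j) * P (axis j 1) f x))"
    by (simp only:) (intro l1_sum, auto intro!: integrable_P f)
  also have "\<dots> \<le> (\<Sum>j\<in>UNIV. \<bar>q $ j - q' $ j\<bar> * l1 f)"
    unfolding l1_scale
    by (intro sum_mono mult_left_mono l1_P f) (auto simp: axis_def)
  finally show ?thesis by (simp add: sum_distrib_right)
qed

end

section \<open>An invariant cone of densities\<close>

lemma left_D_ge_1: "0 < a \<Longrightarrow> 1 \<le> left_D a y"
  by (simp add: left_D_def)

lemma left_D_mono: "0 < a \<Longrightarrow> 0 \<le> y \<Longrightarrow> y \<le> y' \<Longrightarrow> left_D a y \<le> left_D a y'"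
  unfolding left_D_def by (intro add_left_mono mult_left_mono powr_mono2) auto

lemma right_D_mono: "0 \<le> c \<Longrightarrow> 1/2 \<le> y \<Longrightarrow> y \<le> y' \<Longrightarrow> right_D k c y \<le> right_D k c y'"
  unfolding right_D_def by (intro add_left_mono mult_left_mono) auto

text \<open>The gain \<open>x powr a\<close> compensates the mass that the maps \<open>S\<^sub>\<alpha>\<close> carry from the right of
  \<open>1/2\<close> to a neighbourhood of the neutral fixed point.\<close>

lemma left_powr_estimate:
  assumes a: "0 < a" and d: "0 \<le> \<delta>" "\<delta> \<le> 1" and y: "0 < y" "y \<le> 1/2"
  defines "x \<equiv> left_map a y"
  shows "y powr (-\<delta>) / left_D a y \<le> x powr (-\<delta>) * (1 - a / (2 + a) * x powr a)"
proof -
  define u where "u = 2 powr a * y powr a"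
  have u2: "u = (2 * y) powr a" using y by (simp add: u_def powr_mult)
  have u: "0 < u" "u \<le> 1" using y a by (auto simp: u2 intro!: powr_le1)
  have x: "x = y * (1 + u)" using y by (simp add: x_def left_map_def u_def)
  have D: "left_D a y = 1 + (1 + a) * u" using y by (simp add: left_D_def u_def)
  have x0: "0 < x" using x y u by (simp add: add_pos_pos)
  \<comment> \<open>Because x is at most 2y, a gain found in terms of u can be restated in terms of
    x.\<close>
  have "x powr a \<le> u"
    unfolding u2 using left_map_le[of a y] a y x0 by (intro powr_mono2) (auto simp: x_def)
  then have gain: "a / (2 + a) * x powr a \<le> a / (2 + a) * u"
    using a by (intro mult_left_mono) auto
  have "y powr (-\<delta>) = x powr (-\<delta>) * (1 + u) powr \<delta>"
  proof -
    have "x powr (-\<delta>) = y powr (-\<delta>) * (1 + u) powr (-\<delta>)"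
      unfolding x using y u by (intro powr_mult)
    then show ?thesis using u by (simp add: powr_minus)
  qed
  also have "\<dots> \<le> x powr (-\<delta>) * (1 + u)"
    using powr_mono[of \<delta> 1 "1 + u"] d u by (intro mult_left_mono) auto
  finally have "y powr (-\<delta>) / left_D a y \<le> x powr (-\<delta>) * ((1 + u) / (1 + (1 + a) * u))"
    using a u by (simp add: D divide_right_mono add_pos_pos)
  \<comment> \<open>As u is at most 1, the denominator is at most 2 + a; this is the source of the
    constant.\<close>
  also have "(1 + u) / (1 + (1 + a) * u) \<le> 1 - a / (2 + a) * u"
  proof -
    have "a * u / (2 + a) \<le> a * u / (1 + (1 + a) * u)"
      using a u mult_left_le[of u "1 + a"] by (intro divide_left_mono mult_pos_pos add_pos_pos) auto
    moreover have "(1 + u) / (1 + (1 + a) * u) = 1 - a * u / (1 + (1 + a) * u)"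
    proof -
      have "1 + (1 + a) * u \<noteq> 0" using a u by (intro less_imp_neq[symmetric] add_pos_pos mult_pos_pos) auto
      then show ?thesis by (simp add: divide_simps) (simp add: algebra_simps)
    qed
    ultimately show ?thesis by simp
  qed
  also have "\<dots> \<le> 1 - a / (2 + a) * x powr a" using gain by simp
  finally show ?thesis by (simp add: mult_left_mono)
qed

text \<open>With s = y - 1/2 one has x - 1/2 = s w, where w \<ge> k and the slope at y is at least
  w. The identity \<open>s powr (\<gamma> - 1) / w = w powr (-\<gamma>) * (s * w) powr (\<gamma> -
  1)\<close> then isolates the factor \<open>k powr (-\<gamma>)\<close> that is later averaged over
  \<open>R\<close>.\<close>

lemma right_powr_estimate:
  assumes k: "0 < k" "k < 1" and g: "0 < \<gamma>" "\<gamma> \<le> 1" and y: "1/2 < y" "y \<le> 1"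
  defines "x \<equiv> right_map (1/2) k (2 * (1 - k)) y"
  shows "(y - 1/2) powr (\<gamma> - 1) / right_D k (2 * (1 - k)) y \<le> k powr (-\<gamma>) * (x - 1/2) powr (\<gamma> - 1)"
proof -
  define s w where "s = y - 1/2" and "w = k + 2 * (1 - k) * s"
  have s: "0 < s" using y by (simp add: s_def)
  have w: "k \<le> w" "0 < w" using s k by (auto simp: w_def intro: add_pos_nonneg)
  have x: "x - 1/2 = s * w" using y by (simp add: x_def right_map_def s_def w_def algebra_simps)
  have D: "w \<le> right_D k (2 * (1 - k)) y" using y k s by (simp add: w_def right_D_def s_def)
  have "s powr (\<gamma> - 1) / right_D k (2 * (1 - k)) y \<le> s powr (\<gamma> - 1) / w"
    using D w by (intro divide_left_mono) auto
  also have "\<dots> = w powr (-\<gamma>) * (s * w) powr (\<gamma> - 1)"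
    using s w by (simp add: powr_mult powr_diff powr_minus field_simps)
  also have "\<dots> \<le> k powr (-\<gamma>) * (s * w) powr (\<gamma> - 1)"
    using powr_mono2'[of "-\<gamma>" k w] g w k by (intro mult_right_mono) auto
  finally show ?thesis by (simp add: x s_def)
qed

text \<open>The branches are convex on their domains, so a nonnegative decreasing density is divided
  by an increasing slope.\<close>

lemma transfer_antimono:
  assumes "increasing_branch \<phi> D" "x \<le> x'"
    and "g (inv \<phi> x') \<le> g (inv \<phi> x)" "0 \<le> g (inv \<phi> x')" "D (inv \<phi> x) \<le> D (inv \<phi> x')"
  shows "transfer \<phi> D g x' \<le> transfer \<phi> D g x"
  unfolding transfer_def using assms branch_D_pos[OF assms(1)] by (intro frac_le) auto

text \<open>The index \<open>i\<close> attains the minimal exponent. All that the cone knows about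
  the weights is \<open>\<theta>\<close> and the lower bound \<open>c0\<close> for the weight of
  \<open>i\<close>, so one cone serves a whole sequence of weights and its limit.\<close>

locale random_maps_cone = random_maps R \<alpha> K for R :: "'n::finite set" and \<alpha> K +
  fixes i :: 'n and \<gamma> \<theta> c0 :: real
  assumes alpha_min: "\<alpha> i \<le> \<alpha> j"
    and gamma: "\<alpha> i < \<gamma>" "\<gamma> \<le> 1"
    and theta: "0 \<le> \<theta>" "\<theta> < 1"
    and c0_pos: "0 < c0"
begin

text \<open>Chosen so that \<open>x powr (-\<delta>) * x powr \<alpha> i = x powr (\<gamma> -
  1)\<close>: the gain of the left branch has the order of the mass arriving from the right
  half.\<close>

definition \<delta> where "\<delta> = 1 + \<alpha> i - \<gamma>"
text \<open>The fixed point of B = 6 + \<theta> B; the 6 is 4 from the left branches plus 2 from the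
  right ones.\<close>

definition B where "B = 6 / (1 - \<theta>)"
text \<open>Large enough for the gain of index \<open>i\<close>, with weight at least
  \<open>c0\<close>, to pay for \<open>B\<close>; the maximum with 1 lets the indicators of
  \<open>indicator_cone\<close> into the cone.\<close>

definition A where "A = max 1 (B * (2 + \<alpha> i) / (\<alpha> i * c0))"

lemma delta: "0 < \<delta>" "\<delta> < 1" and gamma_pos: "0 < \<gamma>"
  using gamma alpha_pos[of i] by (auto simp: \<delta>_def)

lemma B_ge: "6 \<le> B" "6 + \<theta> * B = B"
proof -
  show "6 \<le> B" using theta by (simp add: B_def field_simps)
  have "1 - \<theta> \<noteq> 0" using theta by simp
  from nonzero_divide_eq_eq[OF this, THEN iffD1, OF refl, of 6]
  have "B * (1 - \<theta>) = 6" by (simp add: B_def)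
  then show "6 + \<theta> * B = B" by (simp add: algebra_simps)
qed

lemma A_ge: "1 \<le> A" "B \<le> c0 * (A * (\<alpha> i / (2 + \<alpha> i)))"
proof -
  have "B = c0 * (B * (2 + \<alpha> i) / (\<alpha> i * c0) * (\<alpha> i / (2 + \<alpha> i)))"
    using alpha_pos[of i] c0_pos by simp
  also have "\<dots> \<le> c0 * (A * (\<alpha> i / (2 + \<alpha> i)))"
    using alpha_pos[of i] c0_pos by (intro mult_left_mono mult_right_mono) (auto simp: A_def)
  finally show "B \<le> \<dots>" .
qed (simp add: A_def)

definition admissible :: "real ^ 'n \<Rightarrow> bool" where
  "admissible q \<longleftrightarrow> pos_prob_vector q \<and> (\<Sum>r\<in>R. q $ r * K r powr (-\<gamma>)) \<le> \<theta> \<and> c0 \<le> q $ i"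

lemma admissibleD:
  assumes "admissible q"
  shows "0 < q $ j" "0 \<le> q $ j" "(\<Sum>j\<in>UNIV. q $ j) = 1"
  using assms by (auto simp: admissible_def pos_prob_vector_def less_imp_le)

text \<open>Every condition is pointwise or a bound on the integral, so it survives pointwise
  dominated limits. The mass is bounded by 1 instead of fixed, which leaves room for indicators of
  short intervals and for multiples of an invariant density.\<close>

definition cone :: "(real \<Rightarrow> real) set" where
  "cone = {f. f \<in> borel_measurable borel \<and> integrable lborel f \<and> (\<forall>x. 0 \<le> f x) \<and> (\<forall>x. x \<notin> {0<..1} \<longrightarrow> f x = 0) \<and>
     (\<forall>x y. 0 < x \<longrightarrow> x \<le> y \<longrightarrow> y \<le> 1/2 \<longrightarrow> f y \<le> f x) \<and>
     (\<forall>x y. 1/2 < x \<longrightarrow> x \<le> y \<longrightarrow> y \<le> 1 \<longrightarrow> f y \<le> f x) \<and>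
     (\<integral>x. f x \<partial>lborel) \<le> 1 \<and>
     (\<forall>x. 0 < x \<longrightarrow> x \<le> 1/2 \<longrightarrow> f x \<le> A * x powr (-\<delta>)) \<and>
     (\<forall>x. 1/2 < x \<longrightarrow> x \<le> 1 \<longrightarrow> f x \<le> B * (x - 1/2) powr (\<gamma> - 1))}"

lemma coneD:
  assumes "f \<in> cone"
  shows "f \<in> borel_measurable borel" "integrable lborel f" "0 \<le> f x" "x \<notin> {0<..1} \<Longrightarrow> f x = 0"
    "0 < x \<Longrightarrow> x \<le> y \<Longrightarrow> y \<le> 1/2 \<Longrightarrow> f y \<le> f x"
    "1/2 < x \<Longrightarrow> x \<le> y \<Longrightarrow> y \<le> 1 \<Longrightarrow> f y \<le> f x"
    "(\<integral>x. f x \<partial>lborel) \<le> 1"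
    "0 < x \<Longrightarrow> x \<le> 1/2 \<Longrightarrow> f x \<le> A * x powr (-\<delta>)"
    "1/2 < x \<Longrightarrow> x \<le> 1 \<Longrightarrow> f x \<le> B * (x - 1/2) powr (\<gamma> - 1)"
  using assms unfolding cone_def by blast+

text \<open>A function that is at least f y on an interval of length y - a has mass at least (y - a)
  f y there, and the total mass is at most 1.\<close>

lemma cone_le_inverse:
  assumes f: "f \<in> cone" and ab: "a < y" and mono: "\<And>x. a < x \<Longrightarrow> x \<le> y \<Longrightarrow> f y \<le> f x"
  shows "f y \<le> 1 / (y - a)"
proof -
  have "(y - a) * f y = (\<integral>x. indicator {a<..y} x * f y \<partial>lborel)"
    using ab by simp
  also have "\<dots> \<le> (\<integral>x. f x \<partial>lborel)"
  proof (rule integral_mono)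
    show "integrable lborel (\<lambda>x. indicator {a<..y} x * f y)"
      using ab by (intro integrable_mult_left integrable_real_indicator) auto
  qed (use coneD[OF f] mono in \<open>auto split: split_indicator\<close>)
  also have "\<dots> \<le> 1" by (rule coneD[OF f])
  finally show ?thesis using ab by (simp add: field_simps)
qed

lemma cone_left_le: "f \<in> cone \<Longrightarrow> 0 < y \<Longrightarrow> y \<le> 1/2 \<Longrightarrow> f y \<le> 1 / y"
  using cone_le_inverse[of f 0 y] coneD(5)[of f] by simp

lemma cone_right_le: "f \<in> cone \<Longrightarrow> 1/2 < y \<Longrightarrow> y \<le> 1 \<Longrightarrow> f y \<le> 1 / (y - 1/2)"
  using cone_le_inverse[of f "1/2" y] coneD(6)[of f] by simp

section \<open>Location of inverse images\<close>

lemma inv_lmap_le: "inv (lmap j) x \<le> y \<longleftrightarrow> x \<le> lmap j y" "y \<le> inv (lmap j) x \<longleftrightarrow> lmap j y \<le> x"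
  "inv (lmap j) x < y \<longleftrightarrow> x < lmap j y" "y < inv (lmap j) x \<longleftrightarrow> lmap j y < x"
  by (simp_all add: inv_branch_le[OF branch_l] inv_branch_less[OF branch_l])

lemma inv_rmap_le: "inv (rmap j) x \<le> y \<longleftrightarrow> x \<le> rmap j y" "y \<le> inv (rmap j) x \<longleftrightarrow> rmap j y \<le> x"
  "inv (rmap j) x < y \<longleftrightarrow> x < rmap j y" "y < inv (rmap j) x \<longleftrightarrow> rmap j y < x"
  by (simp_all add: inv_branch_le[OF branch_r] inv_branch_less[OF branch_r])

lemma inv_lmap_mem: "0 < inv (lmap j) x \<longleftrightarrow> 0 < x" "inv (lmap j) x \<le> 1/2 \<longleftrightarrow> x \<le> 1"
  using inv_lmap_le(1)[of j x "1/2"] inv_lmap_le(4)[of 0 j x] by auto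

lemma inv_rmap_mem: "1/2 < inv (rmap j) x \<longleftrightarrow> (if j \<in> R then 1/2 else 0) < x" "inv (rmap j) x \<le> 1 \<longleftrightarrow> x \<le> 1"
  using inv_rmap_le(1)[of j x "1"] inv_rmap_le(4)[of "1/2" j x] by (simp_all add: rmap_half)

lemma inv_rmap_S: "j \<notin> R \<Longrightarrow> inv (rmap j) x = (x + 1) / 2"
proof -
  assume "j \<notin> R"
  then have "rmap j ((x + 1) / 2) = x" by (simp add: rmap_def right_map_def field_simps)
  then show ?thesis by (metis branch_inv(1)[OF branch_r])
qed

text \<open>The left branch at most doubles, so preimages of the right half stay away from 0; there
  a cone function is at most 4.\<close>

lemma inv_lmap_ge_quarter:
  assumes "1/2 < x"
  shows "1/4 \<le> inv (lmap j) x"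
proof -
  have "lmap j (1/4) \<le> x"
    using assms left_map_le[of "\<alpha> j" "1/4"] alpha_pos[of j] by (simp add: lmap_def)
  then show ?thesis by (simp only: inv_lmap_le)
qed

section \<open>Pointwise bounds for one application of the operator\<close>

lemma l_term_right:
  assumes f: "f \<in> cone" and x: "1/2 < x" "x \<le> 1"
  shows "transfer (lmap j) (lD j) (lpart f) x \<le> 4"
proof -
  define y where "y = inv (lmap j) x"
  have y: "1/4 \<le> y" "y \<le> 1/2" using x inv_lmap_ge_quarter[of x j] inv_lmap_mem(2)[of j x] by (auto simp: y_def)
  have "f y \<le> 1 / y" using cone_left_le[OF f] y by simp
  also have "\<dots> \<le> 4" using y by (simp add: field_simps)
  finally have "f y / lD j y \<le> 4 / 1"
    using left_D_ge_1[OF alpha_pos] by (intro frac_le) (auto simp: lD_def)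
  then show ?thesis using y by (simp add: transfer_def y_def[symmetric])
qed

lemma r_term_right:
  assumes f: "f \<in> cone" and x: "1/2 < x" "x \<le> 1"
  shows "transfer (rmap j) (rD j) (rpart f) x \<le> 2 + (if j \<in> R then B * (K j powr (-\<gamma>) * (x - 1/2) powr (\<gamma> - 1)) else 0)"
proof (cases "j \<in> R")
  case True
  define y where "y = inv (rmap j) x"
  have y: "1/2 < y" "y \<le> 1" "rmap j y = x"
    using x inv_rmap_mem[of j x] True branch_inv(2)[OF branch_r] by (auto simp: y_def)
  have xy: "right_map (1/2) (K j) (2 * (1 - K j)) y = x" using y True by (simp add: rmap_def)
  have D: "0 < rD j y" by (rule branch_D_pos[OF branch_r])
  have "f y / rD j y \<le> B * (y - 1/2) powr (\<gamma> - 1) / rD j y"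
    using coneD(9)[OF f] y D by (intro divide_right_mono) auto
  also have "\<dots> = B * ((y - 1/2) powr (\<gamma> - 1) / right_D (K j) (2 * (1 - K j)) y)"
    using True by (simp add: rD_def)
  also have "\<dots> \<le> B * (K j powr (-\<gamma>) * (x - 1/2) powr (\<gamma> - 1))"
    using right_powr_estimate[of "K j" \<gamma> y] K_bounds[OF True] gamma_pos gamma y B_ge xy
    by (intro mult_left_mono) auto
  finally show ?thesis using y True by (simp add: transfer_def y_def[symmetric])
next
  case False
  \<comment> \<open>For an S map the preimage exceeds 3/4, so f is at most 4 there and the slope 2
    leaves 2. In the R case the summand 2 is slack.\<close>
  have "f ((x + 1) / 2) \<le> 1 / ((x + 1) / 2 - 1/2)"
    using x by (intro cone_right_le[OF f]) auto
  also have "\<dots> \<le> 4" using x by (simp add: field_simps)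
  finally show ?thesis using False x
    by (simp add: transfer_def inv_rmap_S rD_def right_D_def)
qed

lemma l_term_left:
  assumes f: "f \<in> cone" and x: "0 < x" "x \<le> 1/2"
  shows "transfer (lmap j) (lD j) (lpart f) x \<le> A * (x powr (-\<delta>) * (1 - \<alpha> j / (2 + \<alpha> j) * x powr \<alpha> j))"
proof -
  define y where "y = inv (lmap j) x"
  have y: "0 < y" "y \<le> 1/2" "left_map (\<alpha> j) y = x"
    using x inv_lmap_mem[of j x] branch_inv(2)[OF branch_l, of j x] by (auto simp: y_def lmap_def)
  have D: "0 < lD j y" by (rule branch_D_pos[OF branch_l])
  have "f y / lD j y \<le> A * y powr (-\<delta>) / lD j y"
    using coneD(8)[OF f] y D by (intro divide_right_mono) auto
  also have "\<dots> = A * (y powr (-\<delta>) / left_D (\<alpha> j) y)" by (simp add: lD_def)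
  also have "\<dots> \<le> A * (x powr (-\<delta>) * (1 - \<alpha> j / (2 + \<alpha> j) * x powr \<alpha> j))"
    using left_powr_estimate[of "\<alpha> j" \<delta> y] alpha_pos[of j] delta y A_ge
    by (intro mult_left_mono) auto
  finally show ?thesis using y by (simp add: transfer_def y_def[symmetric])
qed

text \<open>R maps send nothing from the right half below 1/2. For an S map the slope 2 compensates
  the factor \<open>2 powr (1 - \<gamma>)\<close> that comes from halving the distance to the
  singularity.\<close>

lemma r_term_left:
  assumes f: "f \<in> cone" and x: "0 < x" "x \<le> 1/2"
  shows "transfer (rmap j) (rD j) (rpart f) x \<le> B * x powr (\<gamma> - 1)"
proof (cases "j \<in> R")
  case True
  then have "\<not> 1/2 < inv (rmap j) x" using x inv_rmap_mem(1)[of j x] by auto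
  then show ?thesis using B_ge by (simp add: transfer_def)
next
  case False
  have "f ((x + 1) / 2) \<le> B * ((x + 1) / 2 - 1/2) powr (\<gamma> - 1)"
    using x by (intro coneD[OF f]) auto
  also have "(x + 1) / 2 - 1/2 = x / 2" by (simp add: field_simps)
  also have "(x / 2) powr (\<gamma> - 1) = x powr (\<gamma> - 1) * 2 powr (1 - \<gamma>)"
    using x by (simp add: powr_divide powr_diff field_simps)
  also have "\<dots> \<le> x powr (\<gamma> - 1) * 2"
    using powr_mono[of "1 - \<gamma>" 1 2] gamma_pos by (intro mult_left_mono) auto
  finally show ?thesis using False x B_ge
    by (simp add: transfer_def inv_rmap_S rD_def right_D_def)
qed

text \<open>The profile z is at least 1 on the right half, so the bounded contributions 4 + 2 are
  absorbed as 6 z, and the equation defining \<open>B\<close> closes the estimate.\<close>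

lemma P_cone_right:
  assumes q: "admissible q" and f: "f \<in> cone" and x: "1/2 < x" "x \<le> 1"
  shows "P q f x \<le> B * (x - 1/2) powr (\<gamma> - 1)"
proof -
  define z where "z = (x - 1/2) powr (\<gamma> - 1)"
  have z: "1 \<le> z"
    using powr_mono2'[of "\<gamma> - 1" "x - 1/2" 1] gamma x by (simp add: z_def)
  have "P q f x \<le> (\<Sum>j\<in>UNIV. q $ j * (4 + (2 + (if j \<in> R then B * (K j powr (-\<gamma>) * z) else 0))))"
    unfolding P_def z_def
    by (intro sum_mono mult_left_mono add_mono l_term_right r_term_right f x admissibleD[OF q])
  also have "\<dots> = (\<Sum>j\<in>UNIV. q $ j * 6 + (if j \<in> R then B * z * (q $ j * K j powr (-\<gamma>)) else 0))"
    by (rule sum.cong) (auto simp: algebra_simps)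
  also have "\<dots> = 6 + B * z * (\<Sum>r\<in>R. q $ r * K r powr (-\<gamma>))"
    using admissibleD(3)[OF q]
    by (simp add: sum.distrib sum_distrib_right[symmetric] sum.If_cases sum_distrib_left)
  also have "\<dots> \<le> 6 * z + B * z * \<theta>"
    using q z B_ge unfolding admissible_def by (intro add_mono mult_left_mono) auto
  also have "\<dots> = (6 + \<theta> * B) * z" by (simp add: algebra_simps)
  finally show ?thesis by (simp only: B_ge z_def)
qed

text \<open>Only the gain e of index \<open>i\<close> is kept: its exponent is the one matched by
  \<open>\<delta>\<close>. The choice of \<open>A\<close> makes this gain, with weight at least
  \<open>c0\<close>, cover the term b arriving from the right half.\<close>

lemma P_cone_left:
  assumes q: "admissible q" and f: "f \<in> cone" and x: "0 < x" "x \<le> 1/2"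
  shows "P q f x \<le> A * x powr (-\<delta>)"
proof -
  define d where "d = x powr (-\<delta>)"
  define e where "e = A * d * (\<alpha> i / (2 + \<alpha> i) * x powr \<alpha> i)"
  define b where "b = B * x powr (\<gamma> - 1)"
  have l: "transfer (lmap j) (lD j) (lpart f) x \<le> A * d - (if j = i then e else 0)" for j
  proof (cases "j = i")
    case False
    have "transfer (lmap j) (lD j) (lpart f) x \<le> A * (d * (1 - \<alpha> j / (2 + \<alpha> j) * x powr \<alpha> j))"
      using l_term_left[OF f x] by (simp add: d_def)
    also have "\<dots> \<le> A * (d * 1)"
      using alpha_pos[of j] A_ge by (intro mult_left_mono) (auto simp: d_def)
    finally show ?thesis using False by simp
  qed (use l_term_left[OF f x, of i] in \<open>simp add: d_def e_def algebra_simps\<close>)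
  have "P q f x \<le> (\<Sum>j\<in>UNIV. q $ j * (A * d - (if j = i then e else 0) + b))"
    unfolding P_def b_def
    by (intro sum_mono mult_left_mono add_mono l r_term_left f x admissibleD[OF q])
  also have "\<dots> = (\<Sum>j\<in>UNIV. q $ j * (A * d + b) - (if j = i then q $ i * e else 0))"
    by (rule sum.cong) (auto simp: algebra_simps)
  also have "\<dots> = A * d + b - q $ i * e"
    using admissibleD(3)[OF q] by (simp add: sum_subtractf sum_distrib_right[symmetric])
  also have "b \<le> q $ i * e"
  proof -
    have "b \<le> (c0 * (A * (\<alpha> i / (2 + \<alpha> i)))) * x powr (\<gamma> - 1)"
      unfolding b_def using A_ge by (intro mult_right_mono) auto
    also have "x powr (\<gamma> - 1) = d * x powr \<alpha> i"
      using x by (simp add: d_def \<delta>_def powr_add[symmetric])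
    also have "c0 * (A * (\<alpha> i / (2 + \<alpha> i))) * (d * x powr \<alpha> i) = c0 * e"
      by (simp add: e_def)
    also have "\<dots> \<le> q $ i * e"
      using q A_ge alpha_pos[of i] unfolding admissible_def
      by (intro mult_right_mono) (auto simp: e_def d_def)
    finally show ?thesis .
  qed
  finally show ?thesis by (simp add: d_def)
qed

section \<open>Monotonicity, support and invariance of the cone\<close>

lemma l_term_antimono:
  assumes f: "f \<in> cone" and x: "0 < x" "x \<le> x'" "x' \<le> 1"
  shows "transfer (lmap j) (lD j) (lpart f) x' \<le> transfer (lmap j) (lD j) (lpart f) x"
proof (rule transfer_antimono[OF branch_l x(2)])
  have le: "inv (lmap j) x \<le> inv (lmap j) x'"
    using x(2) inv_branch_mono[OF branch_l] by (simp add: mono_def)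
  have mem: "0 < inv (lmap j) x" "inv (lmap j) x' \<le> 1/2"
    using x inv_lmap_mem(1)[of j x] inv_lmap_mem(2)[of j x'] by auto
  show "lpart f (inv (lmap j) x') \<le> lpart f (inv (lmap j) x)"
    using coneD(5)[OF f mem(1) le mem(2)] le mem by simp
  show "0 \<le> lpart f (inv (lmap j) x')" using coneD(3)[OF f] by simp
  show "lD j (inv (lmap j) x) \<le> lD j (inv (lmap j) x')"
    using le mem unfolding lD_def by (intro left_D_mono alpha_pos) auto
qed

text \<open>The right branch of an R map covers only (1/2,1], so its term may jump up at 1/2; hence
  both points are kept on the same side.\<close>

lemma r_term_antimono:
  assumes f: "f \<in> cone" and x: "0 < x" "x \<le> x'" "x' \<le> 1/2 \<or> 1/2 < x \<and> x' \<le> 1"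
  shows "transfer (rmap j) (rD j) (rpart f) x' \<le> transfer (rmap j) (rD j) (rpart f) x"
proof (cases "j \<in> R \<and> x' \<le> 1/2")
  case True
  then have "\<not> 1/2 < inv (rmap j) x'" "\<not> 1/2 < inv (rmap j) x"
    using x inv_rmap_mem(1)[of j x] inv_rmap_mem(1)[of j x'] by auto
  then show ?thesis by (simp add: transfer_def)
next
  case False
  show ?thesis
  proof (rule transfer_antimono[OF branch_r x(2)])
    have le: "inv (rmap j) x \<le> inv (rmap j) x'"
      using x(2) inv_branch_mono[OF branch_r] by (simp add: mono_def)
    have mem: "1/2 < inv (rmap j) x" "inv (rmap j) x' \<le> 1"
      using x False inv_rmap_mem(1)[of j x] inv_rmap_mem(2)[of j x'] by auto
    show "rpart f (inv (rmap j) x') \<le> rpart f (inv (rmap j) x)"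
      using coneD(6)[OF f mem(1) le mem(2)] le mem by simp
    show "0 \<le> rpart f (inv (rmap j) x')" using coneD(3)[OF f] by simp
    show "rD j (inv (rmap j) x) \<le> rD j (inv (rmap j) x')"
      using le mem K_bounds[of j] unfolding rD_def by (auto intro!: right_D_mono)
  qed
qed

lemma P_outside:
  assumes "x \<notin> {0<..1}"
  shows "P q f x = 0"
proof -
  have *: "lpart f (inv (lmap j) x) = 0" "rpart f (inv (rmap j) x) = 0" for j
    using assms inv_lmap_mem[of j x] inv_rmap_mem[of j x] by (auto simp: indicator_def split: if_splits)
  show ?thesis
    by (simp only: P_def transfer_def * div_0 add_0 mult_zero_right sum.neutral_const)
qed

lemma P_cone:
  assumes q: "admissible q" and f: "f \<in> cone"
  shows "P q f \<in> cone"
proof -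
  have f0: "indicator {0<..1} y * f y = f y" for y
    using coneD(4)[OF f, of y] by (auto simp: indicator_def)
  have anti: "P q f y \<le> P q f x" if "0 < x" "x \<le> y" "y \<le> 1/2 \<or> 1/2 < x \<and> y \<le> 1" for x y
    unfolding P_def using that
    by (intro sum_mono mult_left_mono add_mono l_term_antimono r_term_antimono f admissibleD[OF q]) auto
  show ?thesis
    unfolding cone_def using coneD[OF f] anti P_outside
    by (auto simp: integrable_P integral_P[OF _ admissibleD(3)[OF q]] f0
        intro!: P_measurable P_nonneg P_cone_left[OF q f] P_cone_right[OF q f] admissibleD[OF q])
qed

lemma cone_average:
  assumes f: "\<And>k. k < n \<Longrightarrow> f k \<in> cone" and n: "0 < n"
  shows "(\<lambda>x. (\<Sum>k<n. f k x) / real n) \<in> cone"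
proof -
  have avg: "(\<Sum>k<n. g k) / real n \<le> c" if "\<And>k. k < n \<Longrightarrow> g k \<le> c" for g :: "nat \<Rightarrow> real" and c
    using sum_mono[of "{..<n}" g "\<lambda>_. c"] that n by (simp add: field_simps)
  have mono: "(\<Sum>k<n. f k y) / real n \<le> (\<Sum>k<n. f k x) / real n" if "\<And>k. k < n \<Longrightarrow> f k y \<le> f k x" for x y
    using that by (intro divide_right_mono sum_mono) auto
  show ?thesis
    unfolding cone_def
  proof (intro CollectI conjI allI impI)
    show "(\<lambda>x. (\<Sum>k<n. f k x) / real n) \<in> borel_measurable borel"
      using coneD(1)[OF f] by (intro borel_measurable_divide borel_measurable_sum) auto
    show "integrable lborel (\<lambda>x. (\<Sum>k<n. f k x) / real n)"
      using coneD(2)[OF f] by (intro integrable_divide Bochner_Integration.integrable_sum) auto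
    have "(\<integral>x. (\<Sum>k<n. f k x) / real n \<partial>lborel) = (\<Sum>k<n. \<integral>x. f k x \<partial>lborel) / real n"
      using coneD(2)[OF f] by (simp add: Bochner_Integration.integral_sum)
    also have "\<dots> \<le> 1" using coneD(7)[OF f] by (intro avg) auto
    finally show "(\<integral>x. (\<Sum>k<n. f k x) / real n \<partial>lborel) \<le> 1" .
    show "(\<Sum>k<n. f k y) / real n \<le> (\<Sum>k<n. f k x) / real n" if "0 < x" "x \<le> y" "y \<le> 1/2" for x y
      using coneD(5)[OF f] that by (intro mono)
    show "(\<Sum>k<n. f k y) / real n \<le> (\<Sum>k<n. f k x) / real n" if "1/2 < x" "x \<le> y" "y \<le> 1" for x y
      using coneD(6)[OF f] that by (intro mono)
  qed (use coneD[OF f] in \<open>auto intro!: divide_nonneg_nonneg sum_nonneg avg\<close>)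
qed

text \<open>These are the seeds for Cesaro averages: b = 1 produces an invariant density, and all b
  together generate the Borel subsets of (0,1].\<close>

lemma indicator_cone:
  assumes b: "0 < b" "b \<le> 1"
  shows "(\<lambda>x. indicator {0<..b} x) \<in> cone"
proof -
  have 1: "1 \<le> A * x powr (-\<delta>)" if "0 < x" "x \<le> 1/2" for x
  proof -
    have "1 \<le> x powr (-\<delta>)" using powr_mono2'[of "-\<delta>" x 1] that delta by simp
    then show ?thesis using A_ge mult_mono[of 1 A 1 "x powr (-\<delta>)"] by simp
  qed
  have 2: "1 \<le> B * (x - 1/2) powr (\<gamma> - 1)" if "1/2 < x" "x \<le> 1" for x
  proof -
    have "1 \<le> (x - 1/2) powr (\<gamma> - 1)" using powr_mono2'[of "\<gamma> - 1" "x - 1/2" 1] that gamma by simp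
    then show ?thesis using B_ge mult_mono[of 1 B 1 "(x - 1/2) powr (\<gamma> - 1)"] by simp
  qed
  have "integrable lborel (indicat_real {0<..b})" "(\<integral>x. indicat_real {0<..b} x \<partial>lborel) \<le> 1"
    using b by simp_all
  then show ?thesis
    unfolding cone_def using b 1 2 order_trans[OF zero_le_one 1] order_trans[OF zero_le_one 2]
    by (auto split: split_indicator)
qed

end

section \<open>Compactness of the cone\<close>

text \<open>The bound depends on the point, as it must near the singularities, so the functions are
  rescaled by 1 + |G x| before the diagonal argument for uniformly bounded sequences.\<close>

lemma bounded_convergent_subsequence:
  fixes f :: "nat \<Rightarrow> 'a \<Rightarrow> real"
  assumes S: "countable S" and f: "\<And>n x. x \<in> S \<Longrightarrow> \<bar>f n x\<bar> \<le> G x"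
  obtains k where "strict_mono (k :: nat \<Rightarrow> nat)" "\<And>x. x \<in> S \<Longrightarrow> convergent (\<lambda>n. f (k n) x)"
proof -
  have "norm (f n x / (1 + \<bar>G x\<bar>)) \<le> 1" if "x \<in> S" for n x
    using f[OF that, of n] by (simp add: abs_divide)
  then obtain k where k: "strict_mono (k :: nat \<Rightarrow> nat)"
    "\<And>x. x \<in> S \<Longrightarrow> \<exists>l. (\<lambda>n. f (k n) x / (1 + \<bar>G x\<bar>)) \<longlonglongrightarrow> l"
    using function_convergent_subsequence[OF S, of "\<lambda>n x. f n x / (1 + \<bar>G x\<bar>)" 1] by blast
  have "convergent (\<lambda>n. f (k n) x)" if x: "x \<in> S" for x
  proof -
    obtain l where "(\<lambda>n. f (k n) x / (1 + \<bar>G x\<bar>)) \<longlonglongrightarrow> l" using k(2)[OF x] by blast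
    then have "(\<lambda>n. f (k n) x / (1 + \<bar>G x\<bar>) * (1 + \<bar>G x\<bar>)) \<longlonglongrightarrow> l * (1 + \<bar>G x\<bar>)"
      by (intro tendsto_intros)
    moreover have "1 + \<bar>G x\<bar> \<noteq> 0" by linarith
    ultimately show ?thesis by (auto simp: convergent_def)
  qed
  with k(1) show ?thesis by (rule that)
qed

text \<open>The core of Helly's theorem. The supremum \<open>lo x\<close> of the limits at rationals
  to the right of x is decreasing in x. Rationals right of x bound the lower limit at x by
  \<open>lo x\<close>, and rationals between y < x and x bound the upper limit by
  \<open>lo y\<close>; both agree where \<open>lo\<close> is continuous.\<close>

lemma countable_not_convergent_antimono:
  fixes f :: "nat \<Rightarrow> real \<Rightarrow> real"
  assumes anti: "\<And>n x y. a < x \<Longrightarrow> x \<le> y \<Longrightarrow> y < b \<Longrightarrow> f n y \<le> f n x"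
    and conv: "\<And>q. q \<in> \<rat> \<Longrightarrow> a < q \<Longrightarrow> q < b \<Longrightarrow> convergent (\<lambda>n. f n q)"
  shows "countable {x \<in> {a<..<b}. \<not> convergent (\<lambda>n. f n x)}"
proof -
  define u where "u q = lim (\<lambda>n. f n q)" for q
  define Q where "Q x = {q \<in> \<rat>. x < q \<and> q < b}" for x
  define lo where "lo x = Sup (u ` Q x)" for x
  have u: "(\<lambda>n. f n q) \<longlonglongrightarrow> u q" if "q \<in> \<rat>" "a < q" "q < b" for q
    using conv[OF that] by (simp add: u_def convergent_LIMSEQ_iff)
  have u_anti: "u q' \<le> u q" if "q \<in> \<rat>" "q' \<in> \<rat>" "a < q" "q \<le> q'" "q' < b" for q q'
    using that by (intro LIMSEQ_le[OF u[of q'] u[of q]] exI[of _ 0]) (auto intro: anti)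
  have Q_ne: "Q x \<noteq> {}" if "x < b" for x
    using Rats_dense_in_real[OF that] by (auto simp: Q_def)
  have bdd: "bdd_above (u ` Q x)" if "a < x" for x
  proof -
    obtain q where "q \<in> \<rat>" "a < q" "q < x" using Rats_dense_in_real[OF \<open>a < x\<close>] by auto
    then show ?thesis by (auto simp: Q_def intro!: bdd_aboveI2[of _ _ "u q"] u_anti)
  qed
  have lo_upper: "u q \<le> lo x" if "a < x" "x < q" "q < b" "q \<in> \<rat>" for q x
    unfolding lo_def using that by (intro cSUP_upper bdd) (auto simp: Q_def)
  have "mono_on {a<..<b} (\<lambda>x. - lo x)"
    unfolding lo_def by (intro mono_onI le_imp_neg_le cSUP_subset_mono bdd Q_ne) (auto simp: Q_def)
  then have cnt: "countable {x \<in> {a<..<b}. \<not> isCont (\<lambda>x. - lo x) x}"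
    by (intro mono_on_ctble_discont_open) auto
  have cv: "convergent (\<lambda>n. f n x)" if x: "a < x" "x < b" and c: "isCont (\<lambda>x. - lo x) x" for x
  proof -
    have lo: "(lo \<longlongrightarrow> lo x) (at x)" using c by (simp add: isCont_def tendsto_minus_cancel_left)
    have "(\<lambda>n. f n x) \<longlonglongrightarrow> lo x"
    proof (rule order_tendstoI)
      fix c assume "c < lo x"
      then obtain q where q: "q \<in> Q x" "c < u q"
        unfolding lo_def using less_cSUP_iff[OF Q_ne[OF x(2)] bdd[OF x(1)]] by blast
      then have "\<forall>\<^sub>F n in sequentially. c < f n q"
        using x by (intro order_tendstoD[OF u]) (auto simp: Q_def)
      then show "\<forall>\<^sub>F n in sequentially. c < f n x"
      proof eventually_elim
        case (elim n)
        have "f n q \<le> f n x" using q x by (intro anti) (auto simp: Q_def)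
        with elim show ?case by simp
      qed
    next
      fix c assume "lo x < c"
      then have "\<forall>\<^sub>F y in at x. lo y < c" by (rule order_tendstoD[OF lo])
      then have "\<forall>\<^sub>F y in at_left x. lo y < c" by (simp add: eventually_at_split)
      moreover have "\<forall>\<^sub>F y in at_left x. y \<in> {a<..<x}" by (rule eventually_at_left_real[OF x(1)])
      ultimately have "\<forall>\<^sub>F y in at_left x. lo y < c \<and> y \<in> {a<..<x}" by (rule eventually_conj)
      then obtain y where y: "lo y < c" "a < y" "y < x"
        using eventually_happens'[OF trivial_limit_at_left_real] by fastforce
      obtain q where q: "q \<in> \<rat>" "y < q" "q < x" using Rats_dense_in_real[OF y(3)] by auto
      have "u q < c" using lo_upper[of y q] y q x by linarith
      then have "\<forall>\<^sub>F n in sequentially. f n q < c"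
        using x y q by (intro order_tendstoD[OF u]) auto
      then show "\<forall>\<^sub>F n in sequentially. f n x < c"
      proof eventually_elim
        case (elim n)
        have "f n x \<le> f n q" using q x y by (intro anti) auto
        with elim show ?case by simp
      qed
    qed
    then show ?thesis by (auto simp: convergent_def)
  qed
  have "{x \<in> {a<..<b}. \<not> convergent (\<lambda>n. f n x)} \<subseteq> {x \<in> {a<..<b}. \<not> isCont (\<lambda>x. - lo x) x}"
    using cv by auto
  then show ?thesis using cnt by (rule countable_subset)
qed

lemma integrable_powr_indicator:
  assumes "-1 < (a::real)" "0 \<le> c"
  shows "integrable lborel (\<lambda>x. indicator {0<..c} x * x powr a)"
proof -
  have "integrable lebesgue (\<lambda>x. indicat_real {0<..c} x *\<^sub>R x powr a)"
    using assms
    by (intro nonnegative_absolutely_integrable_1 [unfolded set_integrable_def] integrable_on_powr_from_0') auto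
  then show ?thesis by (subst integrable_completion[symmetric]) auto
qed

context random_maps_cone
begin

text \<open>The second summand is written as a translate of a power on (0,1/2], so that its
  integrability follows by an affine substitution.\<close>

definition majorant :: "real \<Rightarrow> real" where
  "majorant x = A * (indicator {0<..1/2} x * x powr (-\<delta>)) + B * (indicator {0<..1/2} (x - 1/2) * (x - 1/2) powr (\<gamma> - 1))"

lemma integrable_majorant: "integrable lborel majorant"
proof -
  have "integrable lborel (\<lambda>x. indicat_real {0<..1/2} (- 1/2 + 1 * x) * (- 1/2 + 1 * x) powr (\<gamma> - 1))"
    using gamma_pos by (intro lborel_integrable_real_affine integrable_powr_indicator) auto
  then have "integrable lborel (\<lambda>x. indicat_real {0<..1/2} (x - 1/2) * (x - 1/2) powr (\<gamma> - 1))"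
    by (simp add: add.commute)
  then show ?thesis unfolding majorant_def
    using delta by (intro Bochner_Integration.integrable_add integrable_mult_right integrable_powr_indicator) auto
qed

lemma cone_le_majorant: "f \<in> cone \<Longrightarrow> f x \<le> majorant x"
  using coneD(4)[of f x] coneD(8)[of f x] coneD(9)[of f x]
  by (cases "x \<in> {0<..1}") (auto simp: majorant_def indicator_def)

lemma cone_compact:
  assumes f: "\<And>n. f n \<in> cone"
  obtains s g where "strict_mono (s :: nat \<Rightarrow> nat)" "g \<in> cone" "(\<lambda>n. l1 (\<lambda>x. f (s n) x - g x)) \<longlonglongrightarrow> 0"
proof -
  have bd: "\<bar>f n x\<bar> \<le> majorant x" for n x
    using coneD(3)[OF f] cone_le_majorant[OF f] by simp
  obtain k where k: "strict_mono (k :: nat \<Rightarrow> nat)" "\<And>x. x \<in> \<rat> \<Longrightarrow> convergent (\<lambda>n. f (k n) x)"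
    by (rule bounded_convergent_subsequence[OF countable_rat, of f majorant]) (use bd in auto)
  \<comment> \<open>After the first extraction convergence fails at most on this countable set; a
    second extraction repairs it there. Convergence at every point lets the pointwise conditions of
    the cone pass to the limit.\<close>
  define N where "N = {x \<in> {0<..<1/2}. \<not> convergent (\<lambda>n. f (k n) x)} \<union>
    {x \<in> {1/2<..<1}. \<not> convergent (\<lambda>n. f (k n) x)}"
  have "countable N"
    unfolding N_def
    by (intro countable_Un countable_not_convergent_antimono k) (use coneD(5,6)[OF f] in auto)
  then obtain k' where k': "strict_mono (k' :: nat \<Rightarrow> nat)" "\<And>x. x \<in> N \<Longrightarrow> convergent (\<lambda>n. f (k (k' n)) x)"
    by (rule bounded_convergent_subsequence[of N "\<lambda>n. f (k n)" majorant]) (use bd in auto)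
  define s where "s = k \<circ> k'"
  have s: "strict_mono s" unfolding s_def by (rule strict_mono_o[OF k(1) k'(1)])
  have conv: "convergent (\<lambda>n. f (s n) x)" for x
  proof (cases "convergent (\<lambda>n. f (k n) x)")
    case True
    then show ?thesis
      using convergent_subseq_convergent[OF True k'(1)] by (simp add: s_def o_def)
  next
    case False
    then have "x \<notin> \<rat>" using k(2) by blast
    \<comment> \<open>The points 1/2 and 1, missing from the open intervals in N, are rational and
      thus covered by the first extraction.\<close>
    moreover have "(1/2 :: real) \<in> \<rat>" "(1 :: real) \<in> \<rat>" by (intro Rats_divide) simp_all
    ultimately have "x \<noteq> 1/2" "x \<noteq> 1" by blast+
    moreover have "x \<in> {0<..1}"
    proof (rule ccontr)
      assume "x \<notin> {0<..1}"
      then have "f n x = 0" for n by (rule coneD(4)[OF f])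
      then show False using False by (simp add: convergent_const)
    qed
    ultimately have "x \<in> N" using False by (auto simp: N_def)
    then show ?thesis using k' by (simp add: s_def)
  qed
  define g where "g x = lim (\<lambda>n. f (s n) x)" for x
  have g: "(\<lambda>n. f (s n) x) \<longlonglongrightarrow> g x" for x
    using conv[of x] by (simp add: g_def convergent_LIMSEQ_iff)
  have g_const: "g x \<le> c" if "\<And>n. f n x \<le> c" for x c
    using that by (intro LIMSEQ_le_const2[OF g]) auto
  have g_mono: "g y \<le> g x" if "\<And>n. f n y \<le> f n x" for x y
    using that by (intro LIMSEQ_le[OF g g]) auto
  have g0: "0 \<le> g x" for x
    using coneD(3)[OF f] by (intro LIMSEQ_le_const[OF g]) auto
  have gm[measurable]: "g \<in> borel_measurable borel"
    using coneD(1)[OF f] by (intro borel_measurable_LIMSEQ_real[OF g]) auto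
  have dom: "AE x in lborel. norm (f (s n) x) \<le> majorant x" for n using bd by simp
  have fm: "f (s n) \<in> borel_measurable lborel" for n using coneD(1)[OF f] by simp
  have gi: "integrable lborel g"
    by (rule integrable_dominated_convergence[where s = "\<lambda>n. f (s n)", OF _ fm integrable_majorant _ dom])
       (simp_all add: g)
  have gl: "(\<lambda>n. \<integral>x. f (s n) x \<partial>lborel) \<longlonglongrightarrow> (\<integral>x. g x \<partial>lborel)"
    by (rule integral_dominated_convergence[where s = "\<lambda>n. f (s n)", OF _ fm integrable_majorant _ dom])
       (simp_all add: g)
  have "g \<in> cone"
    unfolding cone_def
  proof (intro CollectI conjI allI impI)
    show "(\<integral>x. g x \<partial>lborel) \<le> 1"
      using coneD(7)[OF f] by (intro LIMSEQ_le_const2[OF gl]) auto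
    show "g x = 0" if "x \<notin> {0<..1}" for x
      using g_const[of x 0] g0[of x] coneD(4)[OF f that] by simp
    show "g y \<le> g x" if "0 < x" "x \<le> y" "y \<le> 1/2" for x y
      using coneD(5)[OF f] that by (intro g_mono)
    show "g y \<le> g x" if "1/2 < x" "x \<le> y" "y \<le> 1" for x y
      using coneD(6)[OF f] that by (intro g_mono)
  qed (auto intro!: g_const coneD(8,9)[OF f] g0 gi)
  moreover have "(\<lambda>n. l1 (\<lambda>x. f (s n) x - g x)) \<longlonglongrightarrow> l1 (\<lambda>x. 0)"
    unfolding l1_def
  proof (rule integral_dominated_convergence[where w = "\<lambda>x. 2 * majorant x"])
    show "(\<lambda>x. \<bar>f (s n) x - g x\<bar>) \<in> borel_measurable lborel" for n
      using fm[of n] gm by (intro borel_measurable_abs borel_measurable_diff) auto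
    have "\<bar>f (s n) x - g x\<bar> \<le> 2 * majorant x" for n x
      using bd[of "s n" x] g0[of x] g_const[of x "majorant x"] cone_le_majorant[OF f] by (smt (verit))
    then show "AE x in lborel. norm \<bar>f (s n) x - g x\<bar> \<le> 2 * majorant x" for n by simp
    show "AE x in lborel. (\<lambda>n. \<bar>f (s n) x - g x\<bar>) \<longlonglongrightarrow> \<bar>0\<bar>"
      by (rule AE_I2, rule tendsto_rabs, rule LIM_zero, rule g)
  qed (use integrable_majorant in auto)
  ultimately show ?thesis
    using that s by (simp add: l1_def)
qed

end

section \<open>Uniqueness of invariant densities in the cone\<close>

text \<open>Replacing (2y) powr a by the larger (2y') powr a enlarges the image of y. The expansion
  factor is governed by the right endpoint, so intervals of a definite length expand definitely even
  next to the neutral fixed point.\<close>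

lemma left_map_growth:
  assumes "0 < a" "0 \<le> y" "y \<le> y'"
  shows "(y' - y) * (1 + (2 * y') powr a) \<le> left_map a y' - left_map a y"
proof -
  have "y * (2 * y) powr a \<le> y * (2 * y') powr a"
    using assms by (intro mult_left_mono powr_mono2) auto
  moreover have "left_map a z = z * (1 + (2 * z) powr a)" if "0 \<le> z" for z
    using that by (simp add: left_map_def powr_mult)
  ultimately show ?thesis using assms by (simp add: algebra_simps)
qed

lemma not_AE_lborel_not_in_interval:
  assumes "a < (b :: real)"
  shows "\<not> (AE x in lborel. x \<notin> {a<..<b})"
proof
  assume "AE x in lborel. x \<notin> {a<..<b}"
  then have "emeasure lborel {a<..<b} = 0" by (subst (asm) AE_iff_measurable[of "{a<..<b}"]) auto
  with assms show False by simp
qed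

context random_maps
begin

lemma integrable_pos_part: "integrable lborel f \<Longrightarrow> integrable lborel (\<lambda>x. max (f x) (0 :: real))"
  by (intro Bochner_Integration.integrable_max) auto

definition invariant :: "real ^ 'n \<Rightarrow> (real \<Rightarrow> real) \<Rightarrow> bool" where
  "invariant q f \<longleftrightarrow> (AE x in lborel. P q f x = f x)"

lemma invariant_diff: "invariant q f \<Longrightarrow> invariant q g \<Longrightarrow> invariant q (\<lambda>x. f x - g x)"
  unfolding invariant_def P_diff by (elim AE_mp) auto

lemma invariant_scale: "invariant q f \<Longrightarrow> invariant q (\<lambda>x. c * f x)"
  unfolding invariant_def P_scale by (elim AE_mp) auto

text \<open>Almost everywhere the image of the positive part e dominates both P f = f and 0, hence
  e. As \<open>P\<close> does not increase mass, the nonnegative difference has integral at most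
  0.\<close>

lemma invariant_pos_part:
  assumes q: "\<And>j. 0 \<le> q $ j" "(\<Sum>j\<in>UNIV. q $ j) = 1"
    and f: "integrable lborel f" and inv: "invariant q f"
  shows "invariant q (\<lambda>x. max (f x) 0)"
proof -
  define e where "e x = max (f x) 0" for x
  have e: "integrable lborel e" unfolding e_def by (rule integrable_pos_part[OF f])
  have Pe: "integrable lborel (P q e)" by (rule integrable_P[OF e])
  have ge: "AE x in lborel. 0 \<le> P q e x - e x"
    using inv unfolding invariant_def
  proof eventually_elim
    case (elim x)
    have "P q f x \<le> P q e x" by (rule P_mono) (auto simp: e_def q)
    moreover have "0 \<le> P q e x" by (rule P_nonneg) (auto simp: e_def q)
    ultimately show ?case using elim by (simp add: e_def)
  qed
  have "integrable lborel (\<lambda>x. indicator {0<..1} x * e x)"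
    using integrable_mult_indicator[OF _ e, of "{0<..1}"] by simp
  then have "(\<integral>x. P q e x \<partial>lborel) \<le> (\<integral>x. e x \<partial>lborel)"
    unfolding integral_P[OF e q(2)]
    by (rule integral_mono[OF _ e]) (auto simp: e_def split: split_indicator)
  then have "(\<integral>x. P q e x - e x \<partial>lborel) \<le> 0" using e Pe by simp
  moreover have "0 \<le> (\<integral>x. P q e x - e x \<partial>lborel)" by (rule integral_nonneg_AE[OF ge])
  ultimately have "AE x in lborel. P q e x - e x = 0"
    using integral_nonneg_eq_0_iff_AE[OF _ ge] e Pe by auto
  then show ?thesis unfolding invariant_def e_def[symmetric] by simp
qed

section \<open>Spreading of positivity by an S map\<close>

definition positive_on :: "(real \<Rightarrow> real) \<Rightarrow> real \<Rightarrow> real \<Rightarrow> bool" where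
  "positive_on e a b \<longleftrightarrow> (AE x in lborel. x \<in> {a<..<b} \<longrightarrow> 0 < e x)"

lemma positive_on_subset: "positive_on e a b \<Longrightarrow> a \<le> a' \<Longrightarrow> b' \<le> b \<Longrightarrow> positive_on e a' b'"
  unfolding positive_on_def by (elim AE_mp) (auto intro!: AE_I2)

context
  fixes q e j
  assumes q: "\<And>j. 0 < q $ j" and e: "\<And>x. 0 \<le> e x" and inv: "invariant q e" and j: "j \<notin> R"
begin

lemma P_ge_terms:
  shows "q $ j * transfer (lmap j) (lD j) (lpart e) x \<le> P q e x" (is ?l)
    and "q $ j * transfer (rmap j) (rD j) (rpart e) x \<le> P q e x" (is ?r)
proof -
  have l: "0 \<le> transfer (lmap j) (lD j) (lpart e) x" and r: "0 \<le> transfer (rmap j) (rD j) (rpart e) x" for j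
    using e branch_D_pos[OF branch_l, of j "inv (lmap j) x"] branch_D_pos[OF branch_r, of j "inv (rmap j) x"]
    by (auto simp: transfer_def intro!: divide_nonneg_pos)
  have "q $ j * (transfer (lmap j) (lD j) (lpart e) x + transfer (rmap j) (rD j) (rpart e) x) \<le> P q e x"
    unfolding P_def using l r q by (intro member_le_sum) (auto simp: less_imp_le)
  then show ?l ?r using l[of j] r[of j] q[of j] by (auto simp: distrib_left intro: order_trans[rotated])
qed

lemma positive_on_lmap:
  assumes ab: "0 \<le> a" "b \<le> 1/2" and pos: "positive_on e a b"
  shows "positive_on e (lmap j a) (lmap j b)"
  unfolding positive_on_def
  using AE_inv_branch[OF branch_l pos[unfolded positive_on_def], of j] inv[unfolded invariant_def]
proof eventually_elim
  case (elim x)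
  show ?case
  proof
    assume "x \<in> {lmap j a<..<lmap j b}"
    then have y: "inv (lmap j) x \<in> {a<..<b}" by (simp add: inv_branch_less[OF branch_l])
    then have "0 < transfer (lmap j) (lD j) (lpart e) x"
      using elim ab branch_D_pos[OF branch_l] by (auto simp: transfer_def)
    then have "0 < q $ j * transfer (lmap j) (lD j) (lpart e) x" using q by simp
    also have "\<dots> \<le> e x" using P_ge_terms(1)[of x] elim by simp
    finally show "0 < e x" .
  qed
qed

lemma positive_on_rmap:
  assumes ab: "1/2 \<le> a" "b \<le> 1" and pos: "positive_on e a b"
  shows "positive_on e (2 * a - 1) (2 * b - 1)"
  unfolding positive_on_def
  using AE_inv_branch[OF branch_r pos[unfolded positive_on_def], of j] inv[unfolded invariant_def]
proof eventually_elim
  case (elim x)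
  show ?case
  proof
    have r: "rmap j z = 2 * z - 1" for z using j by (simp add: rmap_def right_map_def)
    assume "x \<in> {2 * a - 1<..<2 * b - 1}"
    then have y: "inv (rmap j) x \<in> {a<..<b}" by (simp add: inv_branch_less[OF branch_r] r)
    then have "0 < transfer (rmap j) (rD j) (rpart e) x"
      using elim ab branch_D_pos[OF branch_r] by (auto simp: transfer_def)
    then have "0 < q $ j * transfer (rmap j) (rD j) (rpart e) x" using q by simp
    also have "\<dots> \<le> e x" using P_ge_terms(2)[of x] elim by simp
    finally show "0 < e x" .
  qed
qed

text \<open>The lengths of image intervals under \<open>T\<^sub>j\<close> grow geometrically until one of them
  contains \<open>1/2\<close> in its interior.\<close>

lemma positive_on_near_0:
  assumes ab: "0 \<le> a" "a < b" "b \<le> 1" and pos: "positive_on e a b"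
  shows "\<exists>c>0. positive_on e 0 c"
proof (rule ccontr)
  assume none: "\<not> ?thesis"
  \<comment> \<open>One factor for all steps: interval lengths never drop below b - a, so neither
    does the right endpoint that governs the left branch; the right branch expands by 2.\<close>
  define \<kappa> where "\<kappa> = min 2 (1 + (2 * (b - a)) powr \<alpha> j)"
  have \<kappa>: "1 < \<kappa>" "\<kappa> \<le> 2" "\<kappa> \<le> 1 + (2 * (b - a)) powr \<alpha> j" using ab by (auto simp: \<kappa>_def)
  have "\<exists>a' b'. 0 \<le> a' \<and> a' < b' \<and> b' \<le> 1 \<and> positive_on e a' b' \<and> (b - a) * \<kappa> ^ n \<le> b' - a'" for n
  proof (induction n)
    case 0
    show ?case using ab pos by auto
  next
    case (Suc n)
    then obtain a' b' where IH: "0 \<le> a'" "a' < b'" "b' \<le> 1" "positive_on e a' b'" "(b - a) * \<kappa> ^ n \<le> b' - a'"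
      by blast
    have len: "b - a \<le> b' - a'"
    proof -
      have "1 \<le> \<kappa> ^ n" using \<kappa> by (simp add: one_le_power)
      then have "(b - a) * 1 \<le> (b - a) * \<kappa> ^ n" using ab by (intro mult_left_mono) auto
      with IH(5) show ?thesis by simp
    qed
    have grow: "(b - a) * \<kappa> ^ Suc n \<le> (b' - a') * \<kappa>"
      using mult_right_mono[OF IH(5), of \<kappa>] \<kappa> by (simp add: mult_ac)
    consider "b' \<le> 1/2" | "1/2 \<le> a'" | "a' < 1/2" "1/2 < b'" by linarith
    then show ?case
    proof cases
      case 1
      have "(b' - a') * \<kappa> \<le> (b' - a') * (1 + (2 * b') powr \<alpha> j)"
      proof (rule mult_left_mono)
        have "(2 * (b - a)) powr \<alpha> j \<le> (2 * b') powr \<alpha> j"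
          using IH len ab alpha_pos[of j] by (intro powr_mono2) auto
        with \<kappa>(3) show "\<kappa> \<le> 1 + (2 * b') powr \<alpha> j" by linarith
      qed (use IH in simp)
      also have "\<dots> \<le> lmap j b' - lmap j a'"
        unfolding lmap_def using IH alpha_pos[of j] by (intro left_map_growth) auto
      finally have "(b - a) * \<kappa> ^ Suc n \<le> lmap j b' - lmap j a'" using grow by linarith
      moreover have "0 \<le> lmap j a'" "lmap j a' < lmap j b'" "lmap j b' \<le> 1"
        using branch_le_iff[OF branch_l, of j 0 a'] branch_le_iff[OF branch_l, of j b' "1/2"] IH 1
        by (auto simp: branch_less_iff[OF branch_l])
      ultimately show ?thesis using positive_on_lmap[OF IH(1) 1 IH(4)] by blast
    next
      case 2
      have "(b' - a') * \<kappa> \<le> (2 * b' - 1) - (2 * a' - 1)"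
        using mult_left_mono[OF \<kappa>(2), of "b' - a'"] IH by simp
      then have "(b - a) * \<kappa> ^ Suc n \<le> (2 * b' - 1) - (2 * a' - 1)" using grow by linarith
      then show ?thesis
        using positive_on_rmap[OF 2 IH(3) IH(4)] 2 IH by (intro exI[of _ "2 * a' - 1"] exI[of _ "2 * b' - 1"]) auto
    next
      case 3
      \<comment> \<open>The part right of 1/2 is carried onto an interval starting at 0, which
        \<open>none\<close> excludes.\<close>
      then have "positive_on e (1/2) b'" using positive_on_subset[OF IH(4)] by simp
      then have "positive_on e (2 * (1/2) - 1) (2 * b' - 1)" using IH by (intro positive_on_rmap) auto
      then show ?thesis using none 3 by force
    qed
  qed
  moreover obtain n where "1 / (b - a) < \<kappa> ^ n" using real_arch_pow[OF \<kappa>(1)] by blast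
  then have "1 < (b - a) * \<kappa> ^ n" using ab by (simp add: field_simps)
  ultimately show False by (smt (verit))
qed

end

end

context random_maps_cone
begin

lemma cone_AE_isCont:
  assumes f: "f \<in> cone"
  shows "AE x in lborel. x \<in> {0<..<1/2} \<union> {1/2<..<1} \<longrightarrow> isCont f x"
proof -
  have "countable {x \<in> {0<..<1/2}. \<not> isCont (\<lambda>x. - f x) x}"
    using coneD(5)[OF f] by (intro mono_on_ctble_discont_open mono_onI) auto
  moreover have "countable {x \<in> {1/2<..<1}. \<not> isCont (\<lambda>x. - f x) x}"
    using coneD(6)[OF f] by (intro mono_on_ctble_discont_open mono_onI) auto
  ultimately have c: "countable ({x \<in> {0<..<1/2}. \<not> isCont (\<lambda>x. - f x) x} \<union> {x \<in> {1/2<..<1}. \<not> isCont (\<lambda>x. - f x) x})"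
    by (rule countable_Un)
  have "AE x in lborel. x \<notin> {x \<in> {0<..<1/2}. \<not> isCont (\<lambda>x. - f x) x} \<union> {x \<in> {1/2<..<1}. \<not> isCont (\<lambda>x. - f x) x}"
    by (rule AE_not_in[OF countable_imp_null_set_lborel[OF c]])
  then show ?thesis
    by eventually_elim (auto simp: isCont_def tendsto_minus_cancel_left)
qed

text \<open>Piecewise monotone functions are continuous off a countable set, so a difference
  positive on a set of positive measure is positive at a common continuity point, hence on an
  interval around it.\<close>

lemma cone_diff_positive_on:
  assumes f: "f \<in> cone" and g: "g \<in> cone" and ne: "\<not> (AE x in lborel. f x - g x \<le> 0)"
  shows "\<exists>a b. 0 \<le> a \<and> a < b \<and> b \<le> 1 \<and> positive_on (\<lambda>x. max (f x - g x) 0) a b"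
proof -
  have "\<exists>x \<in> {0<..<1/2} \<union> {1/2<..<1}. isCont f x \<and> isCont g x \<and> 0 < f x - g x"
  proof (rule ccontr)
    assume none: "\<not> ?thesis"
    have "AE x in lborel. f x - g x \<le> 0"
      using cone_AE_isCont[OF f] cone_AE_isCont[OF g] AE_lborel_singleton[of "1/2"] AE_lborel_singleton[of 1]
    proof eventually_elim
      case (elim x)
      show ?case
      proof (cases "x \<in> {0<..1}")
        case False
        then show ?thesis using coneD(4)[OF f] coneD(4)[OF g] by simp
      next
        case True
        then have "x \<in> {0<..<1/2} \<union> {1/2<..<1}" using elim by auto
        then show ?thesis using none elim by fastforce
      qed
    qed
    with ne show False by simp
  qed
  then obtain x where x: "x \<in> {0<..<1/2} \<union> {1/2<..<1}" "isCont f x" "isCont g x" "0 < f x - g x" by blast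
  then have "isCont (\<lambda>x. f x - g x) x" by (intro continuous_intros)
  from order_tendstoD(1)[OF tendsto_at_iff_tendsto_nhds[THEN iffD1, OF this[unfolded isCont_def]] x(4)]
  have "\<forall>\<^sub>F y in nhds x. 0 < f y - g y" .
  then obtain d where d: "d > 0" "\<And>y. dist y x < d \<Longrightarrow> 0 < f y - g y"
    unfolding eventually_nhds_metric by blast
  have "positive_on (\<lambda>x. max (f x - g x) 0) (max 0 (x - d)) (min 1 (x + d))"
    unfolding positive_on_def using d(2) by (intro AE_I2) (auto simp: dist_real_def abs_less_iff)
  then show ?thesis using x d(1) by (intro exI[of _ "max 0 (x - d)"] exI[of _ "min 1 (x + d)"]) auto
qed

lemma cone_invariant_unique:
  assumes q: "admissible q" and f: "f \<in> cone" "invariant q f" and g: "g \<in> cone" "invariant q g"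
    and eq: "(\<integral>x. f x \<partial>lborel) = (\<integral>x. g x \<partial>lborel)"
  shows "AE x in lborel. f x = g x"
proof -
  obtain j where j: "j \<notin> R" using ex_S by auto
  have near_0: "\<exists>c>0. positive_on (\<lambda>x. max (f x - g x) 0) 0 c"
    if fg: "f \<in> cone" "invariant q f" "g \<in> cone" "invariant q g" "\<not> (AE x in lborel. f x - g x \<le> 0)" for f g
  proof -
    obtain a b where ab: "0 \<le> a" "a < b" "b \<le> 1" "positive_on (\<lambda>x. max (f x - g x) 0) a b"
      using cone_diff_positive_on[OF fg(1,3,5)] by blast
    have "invariant q (\<lambda>x. max (f x - g x) 0)"
      using fg coneD(2) by (intro invariant_pos_part invariant_diff admissibleD[OF q]) auto
    then show ?thesis
      using ab by (intro positive_on_near_0[OF admissibleD(1)[OF q] _ _ j]) auto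
  qed
  have int: "integrable lborel (\<lambda>x. f x - g x)" "integrable lborel (\<lambda>x. g x - f x)"
    using f g coneD(2) by auto
  have int0: "(\<integral>x. f x - g x \<partial>lborel) = 0" "(\<integral>x. g x - f x \<partial>lborel) = 0"
    using f g coneD(2) eq by auto
  show ?thesis
  proof (cases "AE x in lborel. f x - g x \<le> 0")
    case True
    then have "AE x in lborel. 0 \<le> g x - f x" by eventually_elim simp
    then have "AE x in lborel. g x - f x = 0"
      using integral_nonneg_eq_0_iff_AE[OF int(2)] int0 by simp
    then show ?thesis by eventually_elim simp
  next
    case ne1: False
    show ?thesis
    proof (cases "AE x in lborel. g x - f x \<le> 0")
      case True
      then have "AE x in lborel. 0 \<le> f x - g x" by eventually_elim simp
      then have "AE x in lborel. f x - g x = 0"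
        using integral_nonneg_eq_0_iff_AE[OF int(1)] int0 by simp
      then show ?thesis by eventually_elim simp
    next
      case ne2: False
      obtain c c' where c: "c > 0" "positive_on (\<lambda>x. max (f x - g x) 0) 0 c"
        and c': "c' > 0" "positive_on (\<lambda>x. max (g x - f x) 0) 0 c'"
        using near_0[OF f g ne1] near_0[OF g f ne2] by blast
      from c(2) c'(2) have "AE x in lborel. x \<notin> {0<..<min c c'}"
        unfolding positive_on_def by eventually_elim (auto simp: max_def split: if_splits)
      then show ?thesis using not_AE_lborel_not_in_interval[of 0 "min c c'"] c c' by simp
    qed
  qed
qed

end

section \<open>Uniqueness among integrable densities\<close>

text \<open>This is how compactness and uniqueness of limit points combine into convergence. A
  sequence that does not converge to L stays away from it along an enumerated infinite set of
  indices.\<close>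

lemma tendsto_if_subseq_tendsto:
  fixes X :: "nat \<Rightarrow> 'a::metric_space"
  assumes "\<And>s. strict_mono (s :: nat \<Rightarrow> nat) \<Longrightarrow> \<exists>r. strict_mono (r :: nat \<Rightarrow> nat) \<and> (\<lambda>n. X (s (r n))) \<longlonglongrightarrow> L"
  shows "X \<longlonglongrightarrow> L"
proof (rule ccontr)
  assume "\<not> X \<longlonglongrightarrow> L"
  then obtain e where e: "e > 0" "\<not> (\<forall>\<^sub>F n in sequentially. dist (X n) L < e)"
    unfolding tendsto_iff by blast
  define S where "S = {n. \<not> dist (X n) L < e}"
  have S: "infinite S"
    using e(2) unfolding S_def eventually_cofinite[symmetric] cofinite_eq_sequentially by simp
  define s where "s = enumerate S"
  have "strict_mono s" unfolding s_def by (rule strict_mono_enumerate[OF S])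
  then obtain r where "strict_mono r" "(\<lambda>n. X (s (r n))) \<longlonglongrightarrow> L" using assms by blast
  then obtain n where "dist (X (s (r n))) L < e"
    using e(1) unfolding tendsto_iff eventually_sequentially by blast
  moreover have "s (r n) \<in> S" unfolding s_def by (rule enumerate_in_set[OF S])
  ultimately show False by (simp add: S_def)
qed

context random_maps
begin

lemma l1_cong_AE: "AE x in lborel. f x = g x \<Longrightarrow> f \<in> borel_measurable borel \<Longrightarrow> g \<in> borel_measurable borel \<Longrightarrow> l1 f = l1 g"
  unfolding l1_def by (intro integral_cong_AE) auto

lemma integral_diff_le_l1:
  assumes "integrable lborel f" "integrable lborel g"
  shows "\<bar>(\<integral>x. f x \<partial>lborel) - (\<integral>x. g x \<partial>lborel)\<bar> \<le> l1 (\<lambda>x. f x - g x)"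
proof -
  have "\<bar>\<integral>x. f x - g x \<partial>lborel\<bar> \<le> l1 (\<lambda>x. f x - g x)"
    unfolding l1_def by (rule integral_abs_bound)
  then show ?thesis using assms by simp
qed

text \<open>The average runs over \<open>Suc n\<close> terms, so the denominator is never 0.\<close>

definition cesaro :: "real ^ 'n \<Rightarrow> nat \<Rightarrow> (real \<Rightarrow> real) \<Rightarrow> real \<Rightarrow> real" where
  "cesaro q n f x = (\<Sum>k<Suc n. (P q ^^ k) f x) / real (Suc n)"

lemma integrable_P_funpow: "integrable lborel f \<Longrightarrow> integrable lborel ((P q ^^ k) f)"
  by (induction k) (auto intro: integrable_P)

lemma integrable_cesaro: "integrable lborel f \<Longrightarrow> integrable lborel (cesaro q n f)"
  unfolding cesaro_def
  by (intro integrable_divide Bochner_Integration.integrable_sum integrable_P_funpow)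

lemma P_funpow_add: "(P q ^^ k) (\<lambda>x. f x + g x) x = (P q ^^ k) f x + (P q ^^ k) g x"
proof (induction k arbitrary: x)
  case (Suc k)
  then have "(P q ^^ k) (\<lambda>x. f x + g x) = (\<lambda>x. (P q ^^ k) f x + (P q ^^ k) g x)" by auto
  then show ?case by (simp add: P_add)
qed simp

lemma P_funpow_scale: "(P q ^^ k) (\<lambda>x. c * f x) x = c * (P q ^^ k) f x"
proof (induction k arbitrary: x)
  case (Suc k)
  then have "(P q ^^ k) (\<lambda>x. c * f x) = (\<lambda>x. c * (P q ^^ k) f x)" by auto
  then show ?case by (simp add: P_scale)
qed simp

lemma cesaro_add: "cesaro q n (\<lambda>x. f x + g x) x = cesaro q n f x + cesaro q n g x"
  by (simp only: cesaro_def P_funpow_add sum.distrib add_divide_distrib)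

lemma cesaro_scale: "cesaro q n (\<lambda>x. c * f x) x = c * cesaro q n f x"
  by (simp only: cesaro_def P_funpow_scale sum_distrib_left[symmetric] times_divide_eq_right)

lemma P_cesaro: "P q (cesaro q n f) x - cesaro q n f x = ((P q ^^ Suc n) f x - f x) / real (Suc n)"
proof -
  have "P q (cesaro q n f) x = P q (\<lambda>x. inverse (real (Suc n)) * (\<Sum>k<Suc n. (P q ^^ k) f x)) x"
    by (simp only: cesaro_def[abs_def] divide_inverse mult.commute)
  also have "\<dots> = (\<Sum>k<Suc n. (P q ^^ Suc k) f x) / real (Suc n)"
    by (simp only: P_scale P_sum finite_lessThan divide_inverse mult.commute funpow.simps o_def)
  finally have "P q (cesaro q n f) x - cesaro q n f x =
      (\<Sum>k<Suc n. (P q ^^ Suc k) f x - (P q ^^ k) f x) / real (Suc n)"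
    by (simp only: cesaro_def diff_divide_distrib sum_subtractf)
  also have "\<dots> = ((P q ^^ Suc n) f x - f x) / real (Suc n)"
    by (subst sum_lessThan_telescope) simp
  finally show ?thesis .
qed

context
  fixes q :: "real ^ 'n"
  assumes q: "\<And>j. 0 \<le> q $ j" "(\<Sum>j\<in>UNIV. q $ j) = 1"
begin

lemma l1_P_funpow: "integrable lborel f \<Longrightarrow> l1 ((P q ^^ k) f) \<le> l1 f"
proof (induction k)
  case (Suc k)
  then have "l1 (P q ((P q ^^ k) f)) \<le> l1 ((P q ^^ k) f)"
    by (intro l1_P q integrable_P_funpow)
  with Suc show ?case by simp
qed simp

lemma l1_cesaro:
  assumes f: "integrable lborel f"
  shows "l1 (cesaro q n f) \<le> l1 f"
proof -
  have "l1 (cesaro q n f) = l1 (\<lambda>x. inverse (real (Suc n)) * (\<Sum>k<Suc n. (P q ^^ k) f x))"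
    by (simp only: cesaro_def[abs_def] divide_inverse mult.commute)
  also have "\<dots> \<le> inverse (real (Suc n)) * (\<Sum>k<Suc n. l1 f)"
    unfolding l1_scale
    using order_trans[OF l1_sum[of "{..<Suc n}" "\<lambda>k. (P q ^^ k) f"] sum_mono[OF l1_P_funpow]] f
    by (intro mult_mono) (auto simp: integrable_P_funpow l1_nonneg)
  also have "\<dots> = l1 f" by (simp del: of_nat_Suc)
  finally show ?thesis .
qed

lemma l1_P_cesaro:
  assumes f: "integrable lborel f"
  shows "l1 (\<lambda>x. P q (cesaro q n f) x - cesaro q n f x) \<le> 2 * l1 f / real (Suc n)"
proof -
  have "l1 (\<lambda>x. P q (cesaro q n f) x - cesaro q n f x) =
      l1 (\<lambda>x. inverse (real (Suc n)) * ((P q ^^ Suc n) f x + (-1) * f x))"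
    by (simp only: P_cesaro divide_inverse mult.commute) simp
  also have "\<dots> = inverse (real (Suc n)) * l1 (\<lambda>x. (P q ^^ Suc n) f x + (-1) * f x)"
    unfolding l1_scale by simp
  also have "\<dots> \<le> inverse (real (Suc n)) * (l1 f + l1 f)"
  proof (rule mult_left_mono)
    have "l1 (\<lambda>x. (P q ^^ Suc n) f x + (-1) * f x) \<le> l1 ((P q ^^ Suc n) f) + l1 (\<lambda>x. (-1) * f x)"
      by (intro l1_triangle integrable_P_funpow integrable_mult_right f)
    also have "\<dots> \<le> l1 f + l1 f"
      unfolding l1_scale using l1_P_funpow[OF f, of "Suc n"] by simp
    finally show "l1 (\<lambda>x. (P q ^^ Suc n) f x + (-1) * f x) \<le> l1 f + l1 f" .
  qed simp
  finally show ?thesis by (simp add: divide_inverse mult.commute)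
qed

text \<open>Split P g - g into P (g - f n), P (f n) - f n and f n - g and use contraction. The
  sequence is arbitrary because it will be both a sequence of Cesaro averages and a sequence of
  invariant densities for varying weights.\<close>

lemma invariant_if_almost_invariant_limit:
  assumes f: "\<And>n. integrable lborel (f n)" and g: "integrable lborel g"
    and lim: "(\<lambda>n. l1 (\<lambda>x. f n x - g x)) \<longlonglongrightarrow> 0"
    and almost: "(\<lambda>n. l1 (\<lambda>x. P q (f n) x - f n x)) \<longlonglongrightarrow> 0"
  shows "invariant q g"
proof -
  have "l1 (\<lambda>x. P q g x - g x) \<le> l1 (\<lambda>x. f n x - g x) + (l1 (\<lambda>x. P q (f n) x - f n x) + l1 (\<lambda>x. f n x - g x))" for n
  proof -
    have "l1 (\<lambda>x. P q g x - g x) \<le> l1 (\<lambda>x. P q g x - P q (f n) x) + l1 (\<lambda>x. P q (f n) x - g x)"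
      by (intro l1_triangle_diff integrable_P f g)
    also have "l1 (\<lambda>x. P q g x - P q (f n) x) = l1 (P q (\<lambda>x. f n x - g x))"
      by (subst l1_commute) (simp add: P_diff[abs_def])
    also have "\<dots> \<le> l1 (\<lambda>x. f n x - g x)"
      by (intro l1_P q Bochner_Integration.integrable_diff f g)
    also have "l1 (\<lambda>x. P q (f n) x - g x) \<le> l1 (\<lambda>x. P q (f n) x - f n x) + l1 (\<lambda>x. f n x - g x)"
      by (intro l1_triangle_diff integrable_P f g)
    finally show ?thesis by simp
  qed
  moreover have "(\<lambda>n. l1 (\<lambda>x. f n x - g x) + (l1 (\<lambda>x. P q (f n) x - f n x) + l1 (\<lambda>x. f n x - g x))) \<longlonglongrightarrow> 0 + (0 + 0)"
    by (intro tendsto_intros lim almost)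
  ultimately have "l1 (\<lambda>x. P q g x - g x) \<le> 0 + (0 + 0)"
    by (intro LIMSEQ_le_const) auto
  then have "l1 (\<lambda>x. P q g x - g x) = 0" using l1_nonneg[of "\<lambda>x. P q g x - g x"] by linarith
  then show ?thesis
    unfolding invariant_def using g integrable_P[OF g, of q] by (subst (asm) l1_eq_0_iff) auto
qed

end

end

context random_maps_cone
begin

lemma cone_cesaro:
  assumes q: "admissible q" and f: "f \<in> cone"
  shows "cesaro q n f \<in> cone"
proof -
  have "(P q ^^ k) f \<in> cone" for k
    by (induction k) (auto intro: f P_cone[OF q])
  then show ?thesis unfolding cesaro_def[abs_def] by (intro cone_average) auto
qed

lemma integral_cesaro:
  assumes q: "admissible q" and f: "f \<in> cone"
  shows "(\<integral>x. cesaro q n f x \<partial>lborel) = (\<integral>x. f x \<partial>lborel)"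
proof -
  have "(P q ^^ k) f \<in> cone \<and> (\<integral>x. (P q ^^ k) f x \<partial>lborel) = (\<integral>x. f x \<partial>lborel)" for k
  proof (induction k)
    case (Suc k)
    have "indicator {0<..1} y * (P q ^^ k) f y = (P q ^^ k) f y" for y
      using coneD(4)[OF conjunct1[OF Suc], of y] by (auto simp: indicator_def)
    then have "(\<integral>x. P q ((P q ^^ k) f) x \<partial>lborel) = (\<integral>x. (P q ^^ k) f x \<partial>lborel)"
      by (simp only: integral_P[OF coneD(2)[OF conjunct1[OF Suc]] admissibleD(3)[OF q]])
    then show ?case
      using Suc P_cone[OF q] by simp
  qed (use f in simp)
  then show ?thesis unfolding cesaro_def
    using coneD(2) by (simp add: Bochner_Integration.integral_sum del: sum.lessThan_Suc of_nat_Suc)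
qed

text \<open>A Krylov-Bogolyubov argument in L1: the averages stay in the compact cone, telescoping
  makes them almost invariant, and L1 convergence preserves their common mass.\<close>

lemma cesaro_subseq_limit:
  assumes q: "admissible q" and f: "f \<in> cone" and s: "strict_mono (s :: nat \<Rightarrow> nat)"
  obtains r g where "strict_mono (r :: nat \<Rightarrow> nat)" "g \<in> cone" "invariant q g"
    "(\<integral>x. g x \<partial>lborel) = (\<integral>x. f x \<partial>lborel)"
    "(\<lambda>n. l1 (\<lambda>x. cesaro q (s (r n)) f x - g x)) \<longlonglongrightarrow> 0"
proof -
  obtain r g where r: "strict_mono (r :: nat \<Rightarrow> nat)" and g: "g \<in> cone"
    and lim: "(\<lambda>n. l1 (\<lambda>x. cesaro q (s (r n)) f x - g x)) \<longlonglongrightarrow> 0"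
    by (rule cone_compact[of "\<lambda>n. cesaro q (s n) f"]) (use cone_cesaro[OF q f] in auto)
  have int: "integrable lborel (cesaro q n f)" for n by (rule coneD(2)[OF cone_cesaro[OF q f]])
  have "invariant q g"
  proof (rule invariant_if_almost_invariant_limit[OF admissibleD(2)[OF q] admissibleD(3)[OF q] int coneD(2)[OF g] lim])
    have "(\<lambda>n. 2 * l1 f / real (Suc n)) \<longlonglongrightarrow> 0"
      by (rule LIMSEQ_Suc[OF lim_const_over_n])
    then have "(\<lambda>n. 2 * l1 f / real (Suc (s (r n)))) \<longlonglongrightarrow> 0"
      using LIMSEQ_subseq_LIMSEQ[OF _ strict_mono_o[OF s r]] by (auto simp: o_def)
    then show "(\<lambda>n. l1 (\<lambda>x. P q (cesaro q (s (r n)) f) x - cesaro q (s (r n)) f x)) \<longlonglongrightarrow> 0"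
      by (rule tendsto_sandwich[OF _ _ tendsto_const, rotated 2])
         (use l1_P_cesaro[OF admissibleD(2)[OF q] admissibleD(3)[OF q] coneD(2)[OF f]] in \<open>auto simp: l1_nonneg\<close>)
  qed
  moreover have "(\<integral>x. g x \<partial>lborel) = (\<integral>x. f x \<partial>lborel)"
  proof -
    have "\<bar>(\<integral>x. f x \<partial>lborel) - (\<integral>x. g x \<partial>lborel)\<bar> \<le> l1 (\<lambda>x. cesaro q (s (r n)) f x - g x)" for n
      using integral_diff_le_l1[OF int coneD(2)[OF g]] integral_cesaro[OF q f] by simp
    then have "\<bar>(\<integral>x. f x \<partial>lborel) - (\<integral>x. g x \<partial>lborel)\<bar> \<le> 0"
      by (intro LIMSEQ_le_const[OF lim]) auto
    then show ?thesis by simp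
  qed
  ultimately show ?thesis using that r g lim by blast
qed

lemma ex_invariant_cone:
  assumes q: "admissible q"
  shows "\<exists>f\<in>cone. invariant q f \<and> (\<integral>x. f x \<partial>lborel) = 1"
proof -
  have "(\<lambda>x. indicator {0<..1} x) \<in> cone" by (rule indicator_cone) auto
  from cesaro_subseq_limit[OF q this strict_mono_id] show ?thesis by force
qed

text \<open>The mean ergodic theorem for the single function \<open>g\<close>: its averages tend to
  the multiple of \<open>f0\<close> with the same mass.\<close>

definition cesaro_convergent :: "real ^ 'n \<Rightarrow> (real \<Rightarrow> real) \<Rightarrow> (real \<Rightarrow> real) \<Rightarrow> bool" where
  "cesaro_convergent q f0 g \<longleftrightarrow> integrable lborel g \<and>
     (\<lambda>n. l1 (\<lambda>x. cesaro q n g x - (\<integral>x. g x \<partial>lborel) * f0 x)) \<longlonglongrightarrow> 0"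

context
  fixes q f0
  assumes q: "admissible q" and f0: "f0 \<in> cone" "invariant q f0" "(\<integral>x. f0 x \<partial>lborel) = 1"
begin

lemma cesaro_convergent_error_integrable:
  "integrable lborel g \<Longrightarrow> integrable lborel (\<lambda>x. cesaro q n g x - c * f0 x)"
  by (intro Bochner_Integration.integrable_diff integrable_cesaro integrable_mult_right coneD(2)[OF f0(1)])

lemma cesaro_convergent_scale:
  assumes "cesaro_convergent q f0 g"
  shows "cesaro_convergent q f0 (\<lambda>x. c * g x)"
proof -
  have "l1 (\<lambda>x. cesaro q n (\<lambda>x. c * g x) x - (\<integral>x. c * g x \<partial>lborel) * f0 x)
      = \<bar>c\<bar> * l1 (\<lambda>x. cesaro q n g x - (\<integral>x. g x \<partial>lborel) * f0 x)" for n
    unfolding l1_scale[symmetric] by (simp add: cesaro_scale algebra_simps)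
  moreover have "(\<lambda>n. \<bar>c\<bar> * l1 (\<lambda>x. cesaro q n g x - (\<integral>x. g x \<partial>lborel) * f0 x)) \<longlonglongrightarrow> \<bar>c\<bar> * 0"
    using assms by (intro tendsto_intros) (simp add: cesaro_convergent_def)
  ultimately show ?thesis using assms by (simp add: cesaro_convergent_def)
qed

lemma cesaro_convergent_add:
  assumes g: "cesaro_convergent q f0 g" and h: "cesaro_convergent q f0 h"
  shows "cesaro_convergent q f0 (\<lambda>x. g x + h x)"
proof -
  have int: "integrable lborel g" "integrable lborel h" using g h by (auto simp: cesaro_convergent_def)
  let ?e = "\<lambda>g n. l1 (\<lambda>x. cesaro q n g x - (\<integral>x. g x \<partial>lborel) * f0 x)"
  have le: "?e (\<lambda>x. g x + h x) n \<le> ?e g n + ?e h n" for n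
  proof -
    have "?e (\<lambda>x. g x + h x) n = l1 (\<lambda>x. (cesaro q n g x - (\<integral>x. g x \<partial>lborel) * f0 x) +
        (cesaro q n h x - (\<integral>x. h x \<partial>lborel) * f0 x))"
      using int by (simp add: cesaro_add algebra_simps)
    also have "\<dots> \<le> ?e g n + ?e h n" by (intro l1_triangle cesaro_convergent_error_integrable int)
    finally show ?thesis .
  qed
  have "?e g \<longlonglongrightarrow> 0" "?e h \<longlonglongrightarrow> 0" using g h by (auto simp: cesaro_convergent_def)
  from tendsto_add[OF this] have lim: "(\<lambda>n. ?e g n + ?e h n) \<longlonglongrightarrow> 0" by simp
  have "?e (\<lambda>x. g x + h x) \<longlonglongrightarrow> 0"
    by (rule tendsto_sandwich[OF always_eventually[OF allI[OF l1_nonneg]] always_eventually[OF allI[OF le]] tendsto_const lim])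
  then show ?thesis using int by (simp add: cesaro_convergent_def)
qed

lemma cesaro_convergent_diff: "cesaro_convergent q f0 g \<Longrightarrow> cesaro_convergent q f0 h \<Longrightarrow> cesaro_convergent q f0 (\<lambda>x. g x - h x)"
  using cesaro_convergent_add[of g "\<lambda>x. (-1) * h x"] cesaro_convergent_scale[of h "-1"] by simp

lemma cesaro_convergent_zero: "cesaro_convergent q f0 (\<lambda>x. 0)"
  using cesaro_convergent_scale[of _ 0] f0
  by (simp add: cesaro_convergent_def l1_def cesaro_scale[of q _ 0 "\<lambda>x. 0", simplified])

lemma cesaro_convergent_sum: "finite J \<Longrightarrow> (\<And>k. k \<in> J \<Longrightarrow> cesaro_convergent q f0 (g k)) \<Longrightarrow> cesaro_convergent q f0 (\<lambda>x. \<Sum>k\<in>J. g k x)"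
  by (induction J rule: finite_induct) (auto intro: cesaro_convergent_zero cesaro_convergent_add)

text \<open>Averaging is an L1 contraction and so is the map sending d to (\<integral>d) f0, because
  \<open>f0\<close> has norm 1. Replacing h by g m therefore costs at most twice their distance,
  uniformly in n.\<close>

lemma cesaro_convergent_closed:
  assumes g: "\<And>m. cesaro_convergent q f0 (g m)" and h: "integrable lborel h"
    and lim: "(\<lambda>m. l1 (\<lambda>x. g m x - h x)) \<longlonglongrightarrow> 0"
  shows "cesaro_convergent q f0 h"
proof -
  let ?e = "\<lambda>g n. l1 (\<lambda>x. cesaro q n g x - (\<integral>x. g x \<partial>lborel) * f0 x)"
  have int: "integrable lborel (g m)" for m using g by (auto simp: cesaro_convergent_def)
  have l1_f0: "l1 f0 = 1" using f0(3) coneD(3)[OF f0(1)] by (simp add: l1_def)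
  have le: "?e h n \<le> ?e (g m) n + 2 * l1 (\<lambda>x. g m x - h x)" for n m
  proof -
    define d where "d x = h x - g m x" for x
    have d: "integrable lborel d" unfolding d_def using h int by auto
    have hd: "h = (\<lambda>x. g m x + d x)" by (auto simp: d_def)
    have "?e h n = l1 (\<lambda>x. (cesaro q n (g m) x - (\<integral>x. g m x \<partial>lborel) * f0 x) +
        (cesaro q n d x + (- (\<integral>x. d x \<partial>lborel)) * f0 x))"
      unfolding hd using int d by (simp add: cesaro_add algebra_simps)
    also have "\<dots> \<le> ?e (g m) n + (l1 (cesaro q n d) + l1 (\<lambda>x. (- (\<integral>x. d x \<partial>lborel)) * f0 x))"
      by (rule order_trans[OF l1_triangle add_left_mono[OF l1_triangle]])
         (intro cesaro_convergent_error_integrable int d integrable_cesaro Bochner_Integration.integrable_add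
            integrable_mult_right coneD(2)[OF f0(1)])+
    also have "l1 (cesaro q n d) \<le> l1 d"
      by (rule l1_cesaro[OF admissibleD(2)[OF q] admissibleD(3)[OF q] d])
    also have "l1 (\<lambda>x. (- (\<integral>x. d x \<partial>lborel)) * f0 x) \<le> l1 d"
      unfolding l1_scale l1_f0 by (simp add: l1_def integral_abs_bound)
    also have "l1 d = l1 (\<lambda>x. g m x - h x)" unfolding d_def by (rule l1_commute)
    finally show ?thesis by simp
  qed
  have "?e h \<longlonglongrightarrow> 0"
  proof (rule LIMSEQ_I)
    fix r :: real assume "0 < r"
    then have "\<forall>\<^sub>F m in sequentially. l1 (\<lambda>x. g m x - h x) < r / 4"
      by (intro order_tendstoD(2)[OF lim]) auto
    then obtain m where m: "l1 (\<lambda>x. g m x - h x) < r / 4" by (auto simp: eventually_sequentially)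
    have "?e (g m) \<longlonglongrightarrow> 0" using g by (auto simp: cesaro_convergent_def)
    then have "\<forall>\<^sub>F n in sequentially. ?e (g m) n < r / 2"
      using \<open>0 < r\<close> by (intro order_tendstoD(2)) auto
    then obtain N where N: "\<And>n. n \<ge> N \<Longrightarrow> ?e (g m) n < r / 2" by (auto simp: eventually_sequentially)
    have "norm (?e h n - 0) < r" if "n \<ge> N" for n
      using le[of n m] N[OF that] m l1_nonneg[of "\<lambda>x. cesaro q n h x - (\<integral>x. h x \<partial>lborel) * f0 x"] by simp
    then show "\<exists>N. \<forall>n\<ge>N. norm (?e h n - 0) < r" by blast
  qed
  then show ?thesis using h by (simp add: cesaro_convergent_def)
qed

text \<open>Any limit point is invariant, lies in the cone and has mass b. Since b f0 also lies in
  the cone, uniqueness there identifies the two.\<close>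

lemma cesaro_convergent_interval:
  assumes b: "0 < b" "b \<le> 1"
  shows "cesaro_convergent q f0 (indicator {0<..b})"
proof -
  let ?f = "\<lambda>x. indicator {0<..b} x :: real"
  have f: "?f \<in> cone" by (rule indicator_cone[OF b])
  have int_f: "(\<integral>x. ?f x \<partial>lborel) = b" using b by simp
  have bf0: "(\<lambda>x. b * f0 x) \<in> cone"
  proof -
    have le: "b * f0 x \<le> f0 x" for x using b coneD(3)[OF f0(1), of x] by (simp add: mult_left_le_one_le)
    show ?thesis
      unfolding cone_def
    proof (intro CollectI conjI allI impI)
      show "(\<integral>x. b * f0 x \<partial>lborel) \<le> 1" using b f0 by simp
    qed (use coneD[OF f0(1)] b in \<open>auto intro: order_trans[OF le] mult_left_mono\<close>)
  qed
  have "(\<lambda>n. l1 (\<lambda>x. cesaro q n ?f x - b * f0 x)) \<longlonglongrightarrow> 0"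
  proof (rule tendsto_if_subseq_tendsto)
    fix s :: "nat \<Rightarrow> nat" assume s: "strict_mono s"
    obtain r g where r: "strict_mono (r :: nat \<Rightarrow> nat)" and g: "g \<in> cone" "invariant q g"
      "(\<integral>x. g x \<partial>lborel) = (\<integral>x. ?f x \<partial>lborel)"
      and lim: "(\<lambda>n. l1 (\<lambda>x. cesaro q (s (r n)) ?f x - g x)) \<longlonglongrightarrow> 0"
      by (rule cesaro_subseq_limit[OF q f s])
    have "AE x in lborel. g x = b * f0 x"
      by (rule cone_invariant_unique[OF q g(1,2) bf0 invariant_scale[OF f0(2)]])
         (use g(3) int_f f0 in simp)
    then have "l1 (\<lambda>x. cesaro q n ?f x - g x) = l1 (\<lambda>x. cesaro q n ?f x - b * f0 x)" for n
      using coneD(1)[OF cone_cesaro[OF q f]] coneD(1)[OF g(1)] coneD(1)[OF f0(1)]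
      by (intro l1_cong_AE) auto
    with r lim show "\<exists>r. strict_mono (r :: nat \<Rightarrow> nat) \<and> (\<lambda>n. l1 (\<lambda>x. cesaro q (s (r n)) ?f x - b * f0 x)) \<longlonglongrightarrow> 0"
      by auto
  qed
  then show ?thesis using coneD(2)[OF f] int_f by (simp add: cesaro_convergent_def)
qed

text \<open>Half-lines form an intersection-stable generator whose traces on (0,1] are the intervals
  treated before. Complements follow by linearity and disjoint countable unions by closedness in
  L1.\<close>

lemma cesaro_convergent_indicator:
  assumes "E \<in> sets borel"
  shows "cesaro_convergent q f0 (indicator (E \<inter> {0<..1}))"
proof -
  have E: "E \<in> sigma_sets UNIV (range (\<lambda>a::real. {..a}))"
    using assms by (simp add: borel_eq_atMost)
  have "Int_stable (range (\<lambda>a::real. {..a}))" "range (\<lambda>a::real. {..a}) \<subseteq> Pow UNIV"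
    by (auto simp: Int_stable_def)
  from this E show ?thesis
  proof (induction rule: sigma_sets_induct_disjoint)
    case (basic X)
    then obtain a where X: "X = {..a}" by auto
    show ?case
    proof (cases "0 < a")
      case True
      then have "X \<inter> {0<..1} = {0<..min a 1}" by (auto simp: X)
      then show ?thesis using cesaro_convergent_interval[of "min a 1"] True by simp
    next
      case False
      then have "X \<inter> {0<..1} = {}" by (auto simp: X)
      then show ?thesis using cesaro_convergent_zero by simp
    qed
  next
    case empty
    then show ?case using cesaro_convergent_zero by simp
  next
    case (compl X)
    have "indicator ((UNIV - X) \<inter> {0<..1}) = (\<lambda>x::real. indicator {0<..1} x - indicator (X \<inter> {0<..1}) x :: real)"
      by (auto simp: indicator_def)
    then show ?case using cesaro_convergent_diff[OF cesaro_convergent_interval[of 1] compl(2)] by simp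
  next
    case (union X)
    let ?X = "\<lambda>i. X i \<inter> {0<..1}"
    have Xm: "X i \<in> sets borel" for i using union(2) by (auto simp: borel_eq_atMost)
    have sum_eq: "(\<Sum>i<m. indicator (?X i) x) = (indicator (\<Union>i<m. ?X i) x :: real)" for m x
      using union(1) by (subst indicator_UN_disjoint) (auto simp: disjoint_family_on_def)
    have "cesaro_convergent q f0 (\<lambda>x. \<Sum>i<m. indicator (?X i) x)" for m
      using union(3) by (intro cesaro_convergent_sum) auto
    then have 1: "cesaro_convergent q f0 (indicator (\<Union>i<m. ?X i))" for m by (simp add: sum_eq)
    have i01: "integrable lborel (indicat_real {0<..1::real})" by (intro integrable_real_indicator) auto
    have 2: "integrable lborel (indicator ((\<Union>i. X i) \<inter> {0<..1}) :: real \<Rightarrow> real)"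
      using Xm by (intro Bochner_Integration.integrable_bound[OF i01]) (auto split: split_indicator)
    have "(\<lambda>m. \<integral>x. \<bar>indicat_real (\<Union>i<m. ?X i) x - indicator ((\<Union>i. X i) \<inter> {0<..1}) x\<bar> \<partial>lborel) \<longlonglongrightarrow>
      (\<integral>x. 0 \<partial>(lborel :: real measure))"
    proof (rule integral_dominated_convergence[where w = "indicator {0<..1}"])
      show "AE x in lborel. (\<lambda>m. \<bar>indicat_real (\<Union>i<m. ?X i) x - indicator ((\<Union>i. X i) \<inter> {0<..1}) x\<bar>) \<longlonglongrightarrow> 0"
      proof (rule AE_I2)
        fix x :: real
        have "(\<lambda>m. indicat_real (\<Union>i<m. ?X i) x) \<longlonglongrightarrow> indicator (\<Union>i. ?X i) x"
          by (rule LIMSEQ_indicator_UN)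
        then have "(\<lambda>m. indicat_real (\<Union>i<m. ?X i) x) \<longlonglongrightarrow> indicator ((\<Union>i. X i) \<inter> {0<..1}) x"
          by (simp only: Int_UN_distrib2 UN_simps)
        from tendsto_rabs[OF LIM_zero[OF this]]
        show "(\<lambda>m. \<bar>indicat_real (\<Union>i<m. ?X i) x - indicator ((\<Union>i. X i) \<inter> {0<..1}) x\<bar>) \<longlonglongrightarrow> 0"
          by simp
      qed
    qed (use Xm i01 in \<open>auto split: split_indicator\<close>)
    then have "(\<lambda>m. l1 (\<lambda>x. indicator (\<Union>i<m. ?X i) x - indicator ((\<Union>i. X i) \<inter> {0<..1}) x)) \<longlonglongrightarrow> 0"
      by (simp add: l1_def)
    then show ?case by (rule cesaro_convergent_closed[OF 1 2])
  qed
qed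

lemma cesaro_convergent_integrable:
  assumes "integrable lborel g"
  shows "cesaro_convergent q f0 (\<lambda>x. indicator {0<..1} x * g x)"
  using assms
proof (induct rule: integrable_induct)
  case (base E c)
  have "(\<lambda>x. indicator {0<..1} x * (indicator E x *\<^sub>R c)) = (\<lambda>x. c * indicator (E \<inter> {0<..1}) x)"
    by (auto simp: indicator_def)
  then show ?case using cesaro_convergent_scale[OF cesaro_convergent_indicator[of E], of c] base by (simp only: sets_lborel)
next
  case (add f g)
  then show ?case using cesaro_convergent_add[of "\<lambda>x. indicator {0<..1} x * f x" "\<lambda>x. indicator {0<..1} x * g x"]
    by (simp add: distrib_left)
next
  case (lim f s)
  show ?case
  proof (rule cesaro_convergent_closed[OF lim(2)])
    show int: "integrable lborel (\<lambda>x. indicator {0<..1} x * f x)"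
      using integrable_mult_indicator[OF _ lim(5), of "{0<..1}"] by simp
    have [measurable]: "f \<in> borel_measurable borel" "\<And>i. s i \<in> borel_measurable borel"
      using lim(1,5) by auto
    have "(\<lambda>m. \<integral>x. \<bar>indicator {0<..1} x * s m x - indicator {0<..1} x * f x\<bar> \<partial>lborel) \<longlonglongrightarrow>
        (\<integral>x. 0 \<partial>(lborel :: real measure))"
    proof (rule integral_dominated_convergence[where w = "\<lambda>x. 3 * \<bar>f x\<bar>"])
      show "AE x in lborel. (\<lambda>m. \<bar>indicator {0<..1} x * s m x - indicator {0<..1} x * f x\<bar>) \<longlonglongrightarrow> 0"
      proof (rule AE_I2)
        fix x :: real
        have "(\<lambda>m. indicator {0<..1} x * s m x) \<longlonglongrightarrow> indicator {0<..1} x * f x"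
          by (intro tendsto_intros lim(3)) simp
        from tendsto_rabs[OF LIM_zero[OF this]]
        show "(\<lambda>m. \<bar>indicator {0<..1} x * s m x - indicator {0<..1} x * f x\<bar>) \<longlonglongrightarrow> 0" by simp
      qed
      show "AE x in lborel. norm \<bar>indicator {0<..1} x * s m x - indicator {0<..1} x * f x\<bar> \<le> 3 * \<bar>f x\<bar>" for m
      proof (rule AE_I2)
        fix x :: real
        have "\<bar>s m x\<bar> \<le> 2 * \<bar>f x\<bar>" using lim(4)[of x m] by simp
        then show "norm \<bar>indicator {0<..1} x * s m x - indicator {0<..1} x * f x\<bar> \<le> 3 * \<bar>f x\<bar>"
          by (auto simp: indicator_def)
      qed
    qed (use lim(5) in auto)
    then show "(\<lambda>m. l1 (\<lambda>x. indicator {0<..1} x * s m x - indicator {0<..1} x * f x)) \<longlonglongrightarrow> 0"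
      by (simp add: l1_def)
  qed
qed

text \<open>The averages of an invariant function equal the function itself almost everywhere, while
  mean ergodicity makes them tend to \<open>f0\<close>.\<close>

lemma invariant_density_unique:
  assumes g: "integrable lborel g" "invariant q g" and supp: "\<And>x. x \<notin> {0<..1} \<Longrightarrow> g x = 0"
    and g1: "(\<integral>x. g x \<partial>lborel) = 1"
  shows "AE x in lborel. g x = f0 x"
proof -
  have "(\<lambda>x. indicator {0<..1} x * g x) = g"
  proof
    show "indicator {0<..1} x * g x = g x" for x using supp[of x] by (cases "x \<in> {0<..1}") auto
  qed
  then have "cesaro_convergent q f0 g" using cesaro_convergent_integrable[OF g(1)] by simp
  then have lim: "(\<lambda>n. l1 (\<lambda>x. cesaro q n g x - f0 x)) \<longlonglongrightarrow> 0" by (simp add: cesaro_convergent_def g1)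
  have "AE x in lborel. (P q ^^ k) g x = g x" for k
  proof (induction k)
    case (Suc k)
    from P_AE_cong[OF this, of q] g(2)[unfolded invariant_def] show ?case
      by eventually_elim simp
  qed simp
  then have all: "AE x in lborel. \<forall>k. (P q ^^ k) g x = g x" by (simp add: AE_all_countable)
  have "AE x in lborel. cesaro q n g x - f0 x = g x - f0 x" for n
    using all by eventually_elim (simp add: cesaro_def del: of_nat_Suc sum.lessThan_Suc)
  then have "l1 (\<lambda>x. cesaro q n g x - f0 x) = l1 (\<lambda>x. g x - f0 x)" for n
    using integrable_cesaro[OF g(1), of q n] g(1) coneD(1)[OF f0(1)] by (intro l1_cong_AE) auto
  with lim have "l1 (\<lambda>x. g x - f0 x) = 0" by (simp add: LIMSEQ_const_iff)
  then have "AE x in lborel. g x - f0 x = 0"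
    using g(1) coneD(2)[OF f0(1)] by (subst (asm) l1_eq_0_iff) auto
  then show ?thesis by eventually_elim simp
qed

end

end

section \<open>Continuity in the probability vector\<close>

lemma space_unit_lebesgue [simp]: "space unit_lebesgue = {0..1}"
  by (simp add: unit_lebesgue_def space_restrict_space)

lemma sets_unit_lebesgue: "sets unit_lebesgue = sets (restrict_space borel {0..1})"
  by (auto simp: unit_lebesgue_def sets_restrict_space)

lemma sets_unit_lebesgue_iff: "A \<in> sets unit_lebesgue \<longleftrightarrow> A \<in> sets borel \<and> A \<subseteq> {0..1}"
  unfolding unit_lebesgue_def by (subst sets_restrict_space_iff) auto

lemma sigma_finite_unit_lebesgue: "sigma_finite_measure unit_lebesgue"
  unfolding unit_lebesgue_def by (rule sigma_finite_measure_restrict_space) (auto intro: lborel.sigma_finite_measure_axioms)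

lemma nn_integral_unit_lebesgue: "(\<integral>\<^sup>+x. f x \<partial>unit_lebesgue) = (\<integral>\<^sup>+x. f x * indicator {0..1} x \<partial>lborel)"
  unfolding unit_lebesgue_def by (rule nn_integral_restrict_space) simp

lemma AE_unit_lebesgue: "(AE x in unit_lebesgue. Q x) \<longleftrightarrow> (AE x in lborel. x \<in> {0..1} \<longrightarrow> Q x)"
  unfolding unit_lebesgue_def by (subst AE_restrict_space_iff) auto

lemma measurable_unit_lebesgue: "f \<in> borel_measurable borel \<Longrightarrow> f \<in> borel_measurable unit_lebesgue"
  unfolding unit_lebesgue_def by (rule measurable_restrict_space1) simp

lemma emeasure_density_unit_lebesgue:
  fixes f :: "real \<Rightarrow> real"
  assumes f: "integrable lborel f" "\<And>x. 0 \<le> f x" and E: "E \<in> sets borel" "E \<subseteq> {0..1}"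
  shows "emeasure (density unit_lebesgue (\<lambda>x. ennreal (f x))) E = ennreal (\<integral>x. indicator E x * f x \<partial>lborel)"
proof -
  have "emeasure (density unit_lebesgue (\<lambda>x. ennreal (f x))) E = (\<integral>\<^sup>+x. ennreal (f x) * indicator E x \<partial>unit_lebesgue)"
    using E f by (intro emeasure_density measurable_compose[OF measurable_unit_lebesgue measurable_ennreal]) (auto simp: sets_unit_lebesgue_iff)
  also have "\<dots> = (\<integral>\<^sup>+x. ennreal (indicator E x * f x) \<partial>lborel)"
    unfolding nn_integral_unit_lebesgue using E by (intro nn_integral_cong) (auto split: split_indicator)
  also have "\<dots> = ennreal (\<integral>x. indicator E x * f x \<partial>lborel)"
    using integrable_mult_indicator[OF _ f(1), of E] E f by (intro nn_integral_eq_integral) auto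
  finally show ?thesis .
qed

lemma measure_density_unit_lebesgue:
  fixes f :: "real \<Rightarrow> real"
  assumes f: "integrable lborel f" "\<And>x. 0 \<le> f x" and E: "E \<in> sets borel" "E \<subseteq> {0..1}"
  shows "measure (density unit_lebesgue (\<lambda>x. ennreal (f x))) E = (\<integral>x. indicator E x * f x \<partial>lborel)"
  unfolding measure_def emeasure_density_unit_lebesgue[OF assms] using f(2) by (simp add: integral_nonneg)

context random_maps_cone
begin

text \<open>Each f n is invariant for its own weights and has norm 1, so under the fixed operator
  \<open>P q\<close> it is invariant up to the distance of the weight vectors. Limit points in the
  compact cone are thus invariant for \<open>q\<close>.\<close>

lemma invariant_densities_converge:
  assumes q: "\<And>n. admissible (qn n)" "admissible q" and lim: "qn \<longlonglongrightarrow> q"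
    and f: "\<And>n. f n \<in> cone" "\<And>n. invariant (qn n) (f n)" "\<And>n. (\<integral>x. f n x \<partial>lborel) = 1"
    and f0: "f0 \<in> cone" "invariant q f0" "(\<integral>x. f0 x \<partial>lborel) = 1"
  shows "(\<lambda>n. l1 (\<lambda>x. f n x - f0 x)) \<longlonglongrightarrow> 0"
proof (rule tendsto_if_subseq_tendsto)
  fix s :: "nat \<Rightarrow> nat" assume s: "strict_mono s"
  obtain r g where r: "strict_mono (r :: nat \<Rightarrow> nat)" and g: "g \<in> cone"
    and fg: "(\<lambda>n. l1 (\<lambda>x. f (s (r n)) x - g x)) \<longlonglongrightarrow> 0"
    by (rule cone_compact[of "\<lambda>n. f (s n)"]) (use f in auto)
  have int: "integrable lborel (f n)" for n by (rule coneD(2)[OF f(1)])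
  have l1_f: "l1 (f n) = 1" for n using f(3)[of n] coneD(3)[OF f(1)] by (simp add: l1_def)
  have almost: "l1 (\<lambda>x. P q (f n) x - f n x) \<le> (\<Sum>j\<in>UNIV. \<bar>q $ j - qn n $ j\<bar>)" for n
  proof -
    have "AE x in lborel. P q (f n) x - f n x = P q (f n) x - P (qn n) (f n) x"
      using f(2)[of n] unfolding invariant_def by eventually_elim simp
    then have "l1 (\<lambda>x. P q (f n) x - f n x) = l1 (\<lambda>x. P q (f n) x - P (qn n) (f n) x)"
      using coneD(1)[OF f(1)[of n]] by (intro l1_cong_AE borel_measurable_diff P_measurable) auto
    then show ?thesis using l1_P_diff_weights[OF int[of n], of q "qn n"] by (simp add: l1_f)
  qed
  have lim': "(\<lambda>n. qn (s (r n))) \<longlonglongrightarrow> q"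
    using LIMSEQ_subseq_LIMSEQ[OF lim strict_mono_o[OF s r]] by (simp add: o_def)
  have "(\<lambda>n. \<Sum>j\<in>UNIV. \<bar>q $ j - qn (s (r n)) $ j\<bar>) \<longlonglongrightarrow> (\<Sum>j\<in>UNIV. \<bar>q $ j - q $ j\<bar>)"
    by (intro tendsto_intros lim')
  then have weights: "(\<lambda>n. \<Sum>j\<in>UNIV. \<bar>q $ j - qn (s (r n)) $ j\<bar>) \<longlonglongrightarrow> 0" by simp
  have "invariant q g"
    by (rule invariant_if_almost_invariant_limit[OF admissibleD(2)[OF q(2)] admissibleD(3)[OF q(2)] int coneD(2)[OF g] fg])
       (rule tendsto_sandwich[OF always_eventually[OF allI[OF l1_nonneg]] always_eventually[OF allI[OF almost]] tendsto_const weights])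
  moreover have "(\<integral>x. g x \<partial>lborel) = 1"
  proof -
    have "\<bar>1 - (\<integral>x. g x \<partial>lborel)\<bar> \<le> l1 (\<lambda>x. f (s (r n)) x - g x)" for n
      using integral_diff_le_l1[OF int coneD(2)[OF g], of "s (r n)"] by (simp add: f(3))
    then have "\<bar>1 - (\<integral>x. g x \<partial>lborel)\<bar> \<le> 0" by (intro LIMSEQ_le_const[OF fg]) auto
    then show ?thesis by simp
  qed
  ultimately have "AE x in lborel. g x = f0 x"
    by (intro cone_invariant_unique[OF q(2) g _ f0(1,2)]) (auto simp: f0(3))
  then have "l1 (\<lambda>x. f n x - g x) = l1 (\<lambda>x. f n x - f0 x)" for n
    using coneD(1)[OF f(1)[of n]] coneD(1)[OF g] coneD(1)[OF f0(1)] by (intro l1_cong_AE) auto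
  with r fg show "\<exists>r. strict_mono (r :: nat \<Rightarrow> nat) \<and> (\<lambda>n. l1 (\<lambda>x. f (s (r n)) x - f0 x)) \<longlonglongrightarrow> 0"
    by auto
qed

section \<open>From invariant densities to invariant measures\<close>

context
  fixes T :: "'n \<Rightarrow> real \<Rightarrow> real"
  assumes T: "\<And>j x. x \<in> {0..1} \<Longrightarrow> T j x = tmap j x"
begin

text \<open>The duality for \<open>P\<close> applied to the indicator of E. The density vanishes at
  0, which reconciles the closed interval carrying the measure with the left-open cuts in
  \<open>P\<close>.\<close>

lemma sum_measure_preimages:
  assumes q: "admissible q" and f: "integrable lborel f" "\<And>x. 0 \<le> f x" "\<And>x. x \<notin> {0<..1} \<Longrightarrow> f x = 0"
    and E: "E \<in> sets borel" "E \<subseteq> {0..1}"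
  defines "\<mu> \<equiv> density unit_lebesgue (\<lambda>x. ennreal (f x))"
  shows "(\<Sum>j\<in>UNIV. q $ j * measure \<mu> (T j -` E \<inter> {0..1})) = (\<integral>x. indicator E x * P q f x \<partial>lborel)"
proof -
  have "measure \<mu> (T j -` E \<inter> {0..1}) = (\<integral>y. indicator E (tmap j y) * (indicator {0<..1} y * f y) \<partial>lborel)" for j
  proof -
    have eq: "T j -` E \<inter> {0..1} = (tmap j -` E \<inter> space borel) \<inter> {0..1}" using T by auto
    have m: "(tmap j -` E \<inter> space borel) \<inter> {0..1} \<in> sets borel"
      by (intro sets.Int measurable_sets[OF tmap_measurable E(1)]) auto
    have "indicator (tmap j -` E \<inter> space borel \<inter> {0..1}) y * f y = indicator E (tmap j y) * (indicator {0<..1} y * f y)" for y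
      using f(3)[of y] by (cases "y \<in> {0<..1}") (auto simp: indicator_def)
    then show ?thesis
      unfolding \<mu>_def eq using measure_density_unit_lebesgue[OF f(1,2) m] by (simp only:) auto
  qed
  then show ?thesis
    using E by (subst integral_times_P[OF _ _ f(1)]) (auto simp: indicator_def)
qed

lemma invariant_density_is_acs:
  assumes q: "admissible q" and f: "f \<in> cone" "invariant q f" "(\<integral>x. f x \<partial>lborel) = 1"
  shows "is_acs_measure T q (density unit_lebesgue (\<lambda>x. ennreal (f x)))" (is "is_acs_measure T q ?\<mu>")
proof -
  note fD = coneD(2)[OF f(1)] coneD(3)[OF f(1)] coneD(4)[OF f(1)]
  have fm: "(\<lambda>x. ennreal (f x)) \<in> borel_measurable unit_lebesgue"
    using coneD(1)[OF f(1)] by (intro measurable_compose[OF measurable_unit_lebesgue measurable_ennreal])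
  have "indicator {0..1} x * f x = f x" for x
    using fD(3)[of x] by (cases "x \<in> {0<..1}") auto
  then have "(\<integral>x. indicator {0..1} x * f x \<partial>lborel) = 1" by (simp only: f(3))
  then have "emeasure ?\<mu> {0..1} = 1"
    using emeasure_density_unit_lebesgue[OF fD(1,2), of "{0..1}"] by simp
  then have "prob_space ?\<mu>" by (intro prob_spaceI) simp
  moreover have "absolutely_continuous unit_lebesgue ?\<mu>"
    using absolutely_continuousI_density[OF fm] .
  moreover have "(\<Sum>j\<in>UNIV. q $ j * measure ?\<mu> (T j -` E \<inter> {0..1})) = measure ?\<mu> E"
    if "E \<in> sets (restrict_space borel {0..1})" for E
  proof -
    have E: "E \<in> sets borel" "E \<subseteq> {0..1}" using that by (auto simp: sets_unit_lebesgue[symmetric] sets_unit_lebesgue_iff)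
    have "(\<integral>x. indicator E x * P q f x \<partial>lborel) = (\<integral>x. indicator E x * f x \<partial>lborel)"
    proof (rule integral_cong_AE)
      show "AE x in lborel. indicator E x * P q f x = indicator E x * f x"
        using f(2) unfolding invariant_def by eventually_elim simp
    qed (use E coneD(1)[OF f(1)] P_measurable[OF coneD(1)[OF f(1)], of q] in auto)
    then show ?thesis
      using sum_measure_preimages[OF q fD E] measure_density_unit_lebesgue[OF fD(1,2) E] by simp
  qed
  ultimately show ?thesis
    unfolding is_acs_measure_def by (simp add: sets_unit_lebesgue)
qed

lemma acs_measure_has_density:
  assumes q: "admissible q" and f0: "f0 \<in> cone" "invariant q f0" "(\<integral>x. f0 x \<partial>lborel) = 1"
    and \<mu>: "is_acs_measure T q \<mu>"
  shows "\<mu> = density unit_lebesgue (\<lambda>x. ennreal (f0 x))"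
proof -
  interpret \<mu>: prob_space \<mu> using \<mu> by (simp add: is_acs_measure_def)
  interpret L: sigma_finite_measure unit_lebesgue by (rule sigma_finite_unit_lebesgue)
  have sets_\<mu>: "sets \<mu> = sets unit_lebesgue" and ac: "absolutely_continuous unit_lebesgue \<mu>"
    using \<mu> by (auto simp: is_acs_measure_def sets_unit_lebesgue)
  define D where "D = RN_deriv unit_lebesgue \<mu>"
  have D_meas: "D \<in> borel_measurable unit_lebesgue" unfolding D_def by simp
  have D_dens: "density unit_lebesgue D = \<mu>" unfolding D_def by (rule L.density_RN_deriv[OF ac sets_\<mu>])
  have D_fin: "AE x in unit_lebesgue. D x \<noteq> \<infinity>"
    unfolding D_def by (rule L.RN_deriv_finite[OF \<mu>.sigma_finite_measure ac sets_\<mu>])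
  \<comment> \<open>A version of the Radon-Nikodym derivative on which \<open>P\<close> can act:
    real-valued, Borel on the whole line and zero off (0,1]. It changes the derivative only at 0 and
    where that is infinite.\<close>
  define g where "g x = indicator {0<..1} x * enn2real (D x)" for x
  have g_meas [measurable]: "g \<in> borel_measurable borel"
  proof -
    have "(\<lambda>x. enn2real (D x)) \<in> borel_measurable (restrict_space borel {0..1})"
      using D_meas by (simp add: measurable_cong_sets[OF sets_unit_lebesgue refl])
    then have "(\<lambda>x. indicator {0..1} x *\<^sub>R enn2real (D x)) \<in> borel_measurable borel"
      by (subst (asm) borel_measurable_restrict_space_iff) auto
    then have "(\<lambda>x. indicator {0<..1} x * (indicator {0..1} x *\<^sub>R enn2real (D x))) \<in> borel_measurable borel"
      by (intro borel_measurable_times) auto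
    also have "(\<lambda>x. indicator {0<..1} x * (indicator {0..1} x *\<^sub>R enn2real (D x))) = g"
      by (auto simp: g_def indicator_def)
    finally show ?thesis .
  qed
  have g0: "0 \<le> g x" and g_out: "x \<notin> {0<..1} \<Longrightarrow> g x = 0" for x by (auto simp: g_def)
  have "AE x in unit_lebesgue. D x = ennreal (g x)"
    using D_fin AE_lborel_singleton[of 0] unfolding AE_unit_lebesgue
    by eventually_elim (auto simp: g_def less_top)
  then have \<mu>g: "\<mu> = density unit_lebesgue (\<lambda>x. ennreal (g x))"
    unfolding D_dens[symmetric]
    by (intro density_cong D_meas measurable_compose[OF measurable_unit_lebesgue[OF g_meas] measurable_ennreal])
  have "(\<integral>\<^sup>+x. ennreal (g x) \<partial>lborel) = (\<integral>\<^sup>+x. ennreal (g x) * indicator {0..1} x \<partial>unit_lebesgue)"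
    unfolding nn_integral_unit_lebesgue by (rule nn_integral_cong) (auto simp: g_def indicator_def)
  also have "\<dots> = emeasure \<mu> {0..1}"
    unfolding \<mu>g by (rule emeasure_density[symmetric])
      (auto intro!: measurable_compose[OF measurable_unit_lebesgue[OF g_meas] measurable_ennreal] simp: sets_unit_lebesgue_iff)
  also have "{0..1} = space \<mu>" using sets_eq_imp_space_eq[OF sets_\<mu>] by simp
  finally have nn1: "(\<integral>\<^sup>+x. ennreal (g x) \<partial>lborel) = 1" by (simp add: \<mu>.emeasure_space_1)
  have g_int: "integrable lborel g" using nn1 g0 by (intro integrableI_nonneg) auto
  have g1: "(\<integral>x. g x \<partial>lborel) = 1"
    using nn_integral_eq_integral[OF g_int] g0 nn1 by (simp add: integral_nonneg)
  have Pg: "integrable lborel (P q g)" by (rule integrable_P[OF g_int])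
  \<comment> \<open>Two integrable functions with equal integrals over all Borel sets agree almost
    everywhere. Both vanish off (0,1], so each set may be cut down to [0,1], where invariance of the
    measure applies.\<close>
  have "AE x in lborel. P q g x = g x"
  proof (rule density_unique_real[OF Pg g_int])
    fix E :: "real set" assume "E \<in> sets lborel"
    then have E: "E \<inter> {0..1} \<in> sets borel" "E \<inter> {0..1} \<subseteq> {0..1}" by auto
    then have "E \<inter> {0..1} \<in> sets (restrict_space borel {0..1})"
      by (simp add: sets_unit_lebesgue[symmetric] sets_unit_lebesgue_iff)
    then have inv: "(\<Sum>j\<in>UNIV. q $ j * measure \<mu> (T j -` (E \<inter> {0..1}) \<inter> {0..1})) = measure \<mu> (E \<inter> {0..1})"
      using \<mu> unfolding is_acs_measure_def by blast
    have "(\<integral>x. indicator (E \<inter> {0..1}) x * P q g x \<partial>lborel)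
        = (\<Sum>j\<in>UNIV. q $ j * measure \<mu> (T j -` (E \<inter> {0..1}) \<inter> {0..1}))"
      unfolding \<mu>g by (rule sum_measure_preimages[OF q g_int g0 g_out E, symmetric])
    also have "\<dots> = (\<integral>x. indicator (E \<inter> {0..1}) x * g x \<partial>lborel)"
      unfolding inv unfolding \<mu>g by (rule measure_density_unit_lebesgue[OF g_int g0 E])
    finally have eq: "(\<integral>x. indicator (E \<inter> {0..1}) x * P q g x \<partial>lborel)
        = (\<integral>x. indicator (E \<inter> {0..1}) x * g x \<partial>lborel)" .
    have "indicator (E \<inter> {0..1}) x * P q g x = indicator E x *\<^sub>R P q g x" for x
      using P_outside[of x q g] by (cases "x \<in> {0<..1}") (auto simp: indicator_def)
    moreover have "indicator (E \<inter> {0..1}) x * g x = indicator E x *\<^sub>R g x" for x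
      using g_out[of x] by (cases "x \<in> {0<..1}") (auto simp: indicator_def)
    ultimately show "(\<integral>x\<in>E. P q g x \<partial>lborel) = (\<integral>x\<in>E. g x \<partial>lborel)"
      using eq unfolding set_lebesgue_integral_def by (simp only:)
  qed
  then have "AE x in lborel. g x = f0 x"
    by (intro invariant_density_unique[OF q f0 g_int _ g_out g1]) (simp_all add: invariant_def)
  then have "AE x in unit_lebesgue. ennreal (g x) = ennreal (f0 x)"
    unfolding AE_unit_lebesgue by eventually_elim simp
  then show ?thesis
    unfolding \<mu>g
    by (intro density_cong measurable_compose[OF measurable_unit_lebesgue measurable_ennreal] g_meas coneD(1)[OF f0(1)])
qed

text \<open>Existence and uniqueness give the definite description its meaning; the derivative of
  the resulting measure is then determined almost everywhere.\<close>

lemma acs_density_eq: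
  assumes q: "admissible q" and f: "f \<in> cone" "invariant q f" "(\<integral>x. f x \<partial>lborel) = 1"
  shows "AE x in unit_lebesgue. acs_density T q x = f x"
proof -
  interpret L: sigma_finite_measure unit_lebesgue by (rule sigma_finite_unit_lebesgue)
  have "acs_measure T q = density unit_lebesgue (\<lambda>x. ennreal (f x))"
    unfolding acs_measure_def
    by (rule the_equality) (auto intro: invariant_density_is_acs acs_measure_has_density assms)
  then have "AE x in unit_lebesgue. ennreal (f x) = RN_deriv unit_lebesgue (acs_measure T q) x"
    using coneD(1)[OF f(1)]
    by (intro L.RN_deriv_unique measurable_compose[OF measurable_unit_lebesgue measurable_ennreal]) auto
  then show ?thesis
    by eventually_elim (metis acs_density_def coneD(3)[OF f(1)] enn2real_ennreal)
qed

lemma acs_densities_converge: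
  assumes q: "\<And>n. admissible (qn n)" "admissible q" and lim: "qn \<longlonglongrightarrow> q"
  shows "(\<lambda>n. L1_norm unit_lebesgue (\<lambda>x. acs_density T (qn n) x - acs_density T q x)) \<longlonglongrightarrow> 0"
proof -
  obtain f where f: "\<And>n. f n \<in> cone" "\<And>n. invariant (qn n) (f n)" "\<And>n. (\<integral>x. f n x \<partial>lborel) = 1"
    using ex_invariant_cone[OF q(1)] by metis
  obtain f0 where f0: "f0 \<in> cone" "invariant q f0" "(\<integral>x. f0 x \<partial>lborel) = 1"
    using ex_invariant_cone[OF q(2)] by blast
  have "L1_norm unit_lebesgue (\<lambda>x. acs_density T (qn n) x - acs_density T q x) = ennreal (l1 (\<lambda>x. f n x - f0 x))" for n
  proof -
    have "L1_norm unit_lebesgue (\<lambda>x. acs_density T (qn n) x - acs_density T q x) =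
        (\<integral>\<^sup>+x. ennreal \<bar>f n x - f0 x\<bar> \<partial>unit_lebesgue)"
      unfolding L1_norm_def
    proof (rule nn_integral_cong_AE)
      show "AE x in unit_lebesgue. ennreal \<bar>acs_density T (qn n) x - acs_density T q x\<bar> = ennreal \<bar>f n x - f0 x\<bar>"
        using acs_density_eq[OF q(1)[of n] f(1)[of n] f(2)[of n] f(3)[of n]] acs_density_eq[OF q(2) f0] by eventually_elim simp
    qed
    also have "\<dots> = (\<integral>\<^sup>+x. ennreal \<bar>f n x - f0 x\<bar> \<partial>lborel)"
      unfolding nn_integral_unit_lebesgue
      using coneD(4)[OF f(1)] coneD(4)[OF f0(1)] by (intro nn_integral_cong) (auto simp: indicator_def)
    also have "\<dots> = ennreal (l1 (\<lambda>x. f n x - f0 x))"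
      unfolding l1_def using coneD(2)[OF f(1)] coneD(2)[OF f0(1)] by (intro nn_integral_eq_integral) auto
    finally show ?thesis .
  qed
  moreover have "(\<lambda>n. ennreal (l1 (\<lambda>x. f n x - f0 x))) \<longlonglongrightarrow> ennreal 0"
    by (intro tendsto_ennrealI invariant_densities_converge[OF q lim f f0])
  ultimately show ?thesis by simp
qed

end

end

theorem corollary1p1:
  fixes T :: "'n::finite \<Rightarrow> real \<Rightarrow> real"
    and \<alpha> K :: "'n \<Rightarrow> real"
    and \<alpha>_min :: real
    and p :: "real ^ 'n"
    and pn :: "nat \<Rightarrow> real ^ 'n"
  assumes "\<And>j. T j \<in> S_family \<union> R_family"
    and "Sigma_S T \<noteq> {}" and "Sigma_R T \<noteq> {}"
    and "\<And>j. 0 < \<alpha> j"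
    and "\<And>j x. x \<in> {0..1/2} \<Longrightarrow> T j x = x * (1 + 2 powr \<alpha> j * x powr \<alpha> j)"
    and "\<And>j. j \<in> Sigma_R T \<Longrightarrow> 0 < K j \<and> K j < 1"
    and "\<And>j x. j \<in> Sigma_R T \<Longrightarrow> x \<in> {1/2<..1} \<Longrightarrow>
           T j x = 1/2 + K j * (x - 1/2) + 2 * (1 - K j) * (x - 1/2)\<^sup>2"
    and "\<alpha>_min = Min (range \<alpha>)" and "\<alpha>_min < 1"
    and "pos_prob_vector p"
    and "\<And>n. pos_prob_vector (pn n)"
    and "(SUP n. \<Sum>r\<in>Sigma_R T. pn n $ r * K r powr (- \<alpha>_min)) < 1"
    and "pn \<longlonglongrightarrow> p"
  shows "(\<lambda>n. L1_norm unit_lebesgue (\<lambda>x. acs_density T (pn n) x - acs_density T p x)) \<longlonglongrightarrow> 0"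
proof -
  note T_fam = assms(1) and alpha_pos = assms(4) and T_left = assms(5) and K = assms(6) and T_right = assms(7)
    and prob = assms(10,11) and lim = assms(13)
  define R where "R = Sigma_R T"
  have T_S: "T j x = 2 * x - 1" if "T j \<in> S_family" "x \<in> {1/2<..1}" for j x
    using that by (auto simp: S_family_def S_map_def)
  obtain j0 where j0: "T j0 \<in> S_family" using assms(2) by (auto simp: Sigma_S_def)
  \<comment> \<open>The value at 3/4 separates the families: an S map gives exactly 1/2, an R map
    strictly more.\<close>
  have "j0 \<notin> R"
  proof
    assume "j0 \<in> R"
    then have "T j0 (3/4) > 1/2"
      using T_right[of j0 "3/4"] K[of j0] by (simp add: R_def power2_eq_square field_simps)
    then show False using T_S[OF j0, of "3/4"] by simp
  qed
  then interpret random_maps R \<alpha> K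
    using alpha_pos K by unfold_locales (auto simp: R_def)
  have T: "T j x = tmap j x" if "x \<in> {0..1}" for j x
  proof (cases "x \<le> 1/2")
    case True
    then show ?thesis using T_left[of x j] that by (simp add: tmap_def lmap_def left_map_def)
  next
    case x: False
    show ?thesis
    proof (cases "j \<in> R")
      case True
      then show ?thesis using T_right[of j x, folded R_def] x that
        by (simp add: tmap_def rmap_def right_map_def power2_eq_square)
    next
      case False
      then have "T j \<in> S_family" using T_fam[of j] by (auto simp: R_def Sigma_R_def)
      then show ?thesis using T_S[of j x] False x that by (simp add: tmap_def rmap_def right_map_def)
    qed
  qed
  obtain i where i: "\<alpha>_min = \<alpha> i"
    using Min_in[of "range \<alpha>"] assms(8) by fastforce
  have i_min: "\<alpha> i \<le> \<alpha> j" for j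
    using assms(8) unfolding i[symmetric] by simp
  define S where "S q = (\<Sum>r\<in>R. q $ r * K r powr (- \<alpha> i))" for q :: "real ^ 'n"
  define s where "s = (SUP n. S (pn n))"
  have s1: "s < 1" using assms(12) by (simp add: s_def S_def R_def i)
  have S_le: "S (pn n) \<le> s" for n
  proof -
    \<comment> \<open>A real supremum bounds its terms only when the set is bounded above; this
      holds because the weights are at most 1.\<close>
    have "S (pn n) \<le> (\<Sum>r\<in>R. 1 * K r powr (- \<alpha> i))" for n
    proof -
      have "pn n $ r \<le> 1" for r
        using member_le_sum[of r UNIV "\<lambda>r. pn n $ r"] prob(2)[of n]
        by (auto simp: pos_prob_vector_def less_imp_le)
      then show ?thesis unfolding S_def by (intro sum_mono mult_right_mono) auto
    qed
    then show ?thesis unfolding s_def by (intro cSUP_upper bdd_aboveI2) auto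
  qed
  have "(\<lambda>n. S (pn n)) \<longlonglongrightarrow> S p"
    unfolding S_def by (intro tendsto_intros lim)
  then have Sp: "S p \<le> s" using S_le by (intro LIMSEQ_le_const2) auto
  have s0: "0 \<le> s"
    using prob(1) by (intro order_trans[OF _ Sp]) (auto simp: S_def pos_prob_vector_def less_imp_le intro!: sum_nonneg)
  \<comment> \<open>With m below every \<open>K r\<close>, raising the exponent by \<eta> costs at
    most the factor \<open>m powr (- \<eta>)\<close>, which tends to 1; hence some positive \<eta>
    keeps the product with s below 1.\<close>
  define m where "m = Min (K ` R)"
  have "R \<noteq> {}" using assms(3) by (simp add: R_def)
  then have m: "0 < m" "\<And>r. r \<in> R \<Longrightarrow> m \<le> K r"
    using K by (auto simp: m_def R_def)
  have "((\<lambda>\<eta>. s * m powr (- \<eta>)) \<longlongrightarrow> s * m powr (- 0)) (at_right 0)"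
    using m by (intro tendsto_intros) auto
  then have "\<forall>\<^sub>F \<eta> in at_right 0. s * m powr (- \<eta>) < 1"
    using m s1 by (intro order_tendstoD) auto
  \<comment> \<open>The assumption \<open>\<alpha>_min < 1\<close> leaves room for \<gamma> =
    \<open>\<alpha> i + \<eta>\<close> below 1.\<close>
  moreover have "\<forall>\<^sub>F \<eta> in at_right 0. \<eta> \<in> {0<..<1 - \<alpha> i}"
    using assms(9) i by (intro eventually_at_right_real) simp
  ultimately have "\<forall>\<^sub>F \<eta> in at_right 0. s * m powr (- \<eta>) < 1 \<and> \<eta> \<in> {0<..<1 - \<alpha> i}" by (rule eventually_conj)
  then obtain \<eta> where \<eta>: "s * m powr (- \<eta>) < 1" "0 < \<eta>" "\<eta> < 1 - \<alpha> i"
    using eventually_happens'[OF trivial_limit_at_right_real] by fastforce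
  have "\<exists>c>0. (\<forall>n. c \<le> pn n $ i) \<and> c \<le> p $ i"
  proof -
    have pi: "0 < p $ i" "0 < pn n $ i" for n using prob by (auto simp: pos_prob_vector_def)
    have "\<forall>\<^sub>F n in sequentially. p $ i / 2 < pn n $ i"
      using pi(1) by (intro order_tendstoD[OF tendsto_vec_nth[OF lim]]) auto
    then obtain N where N: "\<And>n. n \<ge> N \<Longrightarrow> p $ i / 2 < pn n $ i" by (auto simp: eventually_sequentially)
    \<comment> \<open>Convergence to the positive weight p i bounds all but finitely many weights
      below by half of it; the minimum takes care of the rest.\<close>
    define c where "c = Min (insert (p $ i / 2) ((\<lambda>n. pn n $ i) ` {..<N}))"
    have "0 < c" using pi by (auto simp: c_def)
    moreover have "c \<le> p $ i / 2" unfolding c_def by (intro Min_le) auto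
    moreover have "c \<le> pn n $ i" for n
    proof (cases "n < N")
      case True
      then show ?thesis by (auto simp: c_def intro!: Min_le)
    next
      case False
      then show ?thesis using N[of n] \<open>c \<le> p $ i / 2\<close> by simp
    qed
    ultimately show ?thesis using pi by (intro exI[of _ c]) auto
  qed
  then obtain c where c: "0 < c" "\<And>n. c \<le> pn n $ i" "c \<le> p $ i" by blast
  interpret random_maps_cone R \<alpha> K i "\<alpha> i + \<eta>" "s * m powr (- \<eta>)" c
    using i_min \<eta> s0 c by unfold_locales auto
  have adm: "admissible q" if q: "pos_prob_vector q" "S q \<le> s" "c \<le> q $ i" for q
  proof -
    have "(\<Sum>r\<in>R. q $ r * K r powr - (\<alpha> i + \<eta>)) \<le> (\<Sum>r\<in>R. q $ r * K r powr (- \<alpha> i) * m powr (- \<eta>))"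
    proof (rule sum_mono)
      fix r assume r: "r \<in> R"
      have "K r powr (- \<eta>) \<le> m powr (- \<eta>)"
        using m r \<eta> by (intro powr_mono2') auto
      then have "q $ r * K r powr (- \<alpha> i) * K r powr (- \<eta>) \<le> q $ r * K r powr (- \<alpha> i) * m powr (- \<eta>)"
        using q(1) by (intro mult_left_mono) (auto simp: pos_prob_vector_def less_imp_le)
      then show "q $ r * K r powr - (\<alpha> i + \<eta>) \<le> q $ r * K r powr (- \<alpha> i) * m powr (- \<eta>)"
        by (simp add: mult.assoc powr_add[symmetric])
    qed
    also have "\<dots> = S q * m powr (- \<eta>)" by (simp add: S_def sum_distrib_right)
    also have "\<dots> \<le> s * m powr (- \<eta>)" using q by (intro mult_right_mono) auto
    finally show ?thesis using q by (simp add: admissible_def)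
  qed
  show ?thesis
    by (rule acs_densities_converge[OF T adm[OF prob(2) S_le c(2)] adm[OF prob(1) Sp c(3)] lim])
qed

end
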